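(* Let $p,q\in\mathbb P_{\mathbb K}V$ be distinct and nonisotropic points that span a euclidean projective line and let $t\in T_p\mathbb P_{\mathbb K}V$. Then the parallel transport (for the Levi-Civita connection of the metric) of $t$ from $p$ to $q$ along $G[p,q]$ is given by $\mathrm{Eu}(t)(q)$.
   Context: $\mathbb K$ is $\mathbb R$, $\mathbb C$ or $\mathbb H$ (quaternions). $V$ is a finite-dimensional right $\mathbb K$-vector space with a nondegenerate hermitian form $\langle-,-\rangle$: it takes values in $\mathbb K$, is biadditive, and satisfies $\langle v_1k,v_2\rangle=\overline k\langle v_1,v_2\rangle$, $\langle v_1,v_2k\rangle=\langle v_1,v_2\rangle k$, $\langle v_1,v_2\rangle=\overline{\langle v_2,v_1\rangle}$. A point of $\mathbb P_{\mathbb K}V$, a representative in $V$, and the corresponding one-dimensional subspace are denoted by the same letter. A point $p$ is isotropic if $\langle p,p\rangle=0$; $SV$ is the set of isotropic points. Points $p,q$ are orthogonal if $\langle p,q\rangle=0$. For $p$ nonisotropic, $\pi'[p]v:=p\frac{\langle p,v\rangle}{\langle p,p\rangle}$ and $\pi[p]v:=v-\pi'[p]v$ are the orthogonal projections onto $p$ and $p^\perp$, and $T_p\mathbb P_{\mathbb K}V=\mathrm{Lin}_{\mathbb K}(p,p^\perp)$, where $\varphi:p\to p^\perp$ corresponds to the derivation $f\mapsto\frac{d}{d\varepsilon}|_{\varepsilon=0}\hat f(p+\varepsilon\varphi p)$, $\hat f$ being the lift of $f$ to $V\setminus\{0\}$. Extending by zero on $p^\perp$, tangent vectors at $p$ are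 regarded as elements of $\mathrm{Lin}_{\mathbb K}(V,V)$. The metric is $(t_1,t_2):=\pm\frac{\mathrm{tr}_{\mathbb R}(t_1^*t_2)}{\dim_{\mathbb R}\mathbb K}$ for $t_1,t_2\in T_p\mathbb P_{\mathbb K}V$ (one of the signs being fixed), where $t_1^*$ is the adjoint with respect to $\langle-,-\rangle$; it is a pseudo-riemannian metric on $\mathbb P_{\mathbb K}V\setminus SV$. A projective line is the projectivization of a 2-dimensional $\mathbb K$-subspace; it is euclidean if the form on this subspace is nonnull and degenerate. A geodesic is a circle $\mathbb P_{\mathbb K}W\subset\mathbb P_{\mathbb K}V$ (the image of $W\setminus\{0\}$), where $W\subset V$ is a 2-dimensional real subspace on which the hermitian form is real-valued and not identically zero. Two distinct nonorthogonal points $p,q$ lie on a unique geodesic; for $p$ nonisotropic, $G[p,q]$ is the oriented segment of this geodesic from $p$ to $q$ that does not contain the point orthogonal to $p$ (the unique point of the projective line spanned by $p,q$ that is orthogonal to $p$). (Distinct nonisotropic points of a euclidean line are nonorthogonal.) For $t\in\mathrm{Lin}_{\mathbb K}(V,V)$ and $x$ nonisotropic put $t_x:=\pi[x]\,t\,\pi'[x]\in T_x\mathbb P_{\mathbb K}V$. For a tangent vector $s$ at $p$ and $x$ nonisotropic, $\mathrm{Eu}(s)(x):=\frac12\big(\pi[p]\pi'[x]s\big)_x+s_x$. *)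

theory Defs
  imports "HOL-Analysis.Analysis"
begin

section \<open>Scalars: the real numbers, the complex numbers and the quaternions\<close>

text \<open>
  By Frobenius' theorem every type of this class is isomorphic to the reals, the complex numbers
  or the quaternions. The conjugation is forced by the axioms: the last one says
  \<open>hconj x = (norm x)\<^sup>2 *\<^sub>R inverse x\<close> for \<open>x \<noteq> 0\<close>. The three
  instances are given below.
\<close>

class hermitian_scalar = real_normed_div_algebra + euclidean_space +
  fixes hconj :: "'a \<Rightarrow> 'a"
  assumes hconj_add: "hconj (x + y) = hconj x + hconj y"
    and hconj_mult: "hconj (x * y) = hconj y * hconj x"
    and hconj_hconj: "hconj (hconj x) = x"
    and hconj_scaleR_1: "hconj (r *\<^sub>R 1) = r *\<^sub>R 1"
    and hconj_mult_self: "hconj x * x = (norm x)\<^sup>2 *\<^sub>R 1"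

instantiation real :: hermitian_scalar
begin
definition hconj_real :: "real \<Rightarrow> real" where "hconj_real x = x"
instance
  by standard (simp_all add: hconj_real_def power2_eq_square)
end

instantiation complex :: hermitian_scalar
begin
definition hconj_complex :: "complex \<Rightarrow> complex" where "hconj_complex x = cnj x"
instance
proof
  fix x :: complex
  show "hconj x * x = (norm x)\<^sup>2 *\<^sub>R 1"
    by (metis complex_norm_square hconj_complex_def mult.commute of_real_def)
qed (simp_all add: hconj_complex_def)
end

datatype quat = Quat (q0: real) (q1: real) (q2: real) (q3: real)

lemma quat_eq_iff: "x = y \<longleftrightarrow> q0 x = q0 y \<and> q1 x = q1 y \<and> q2 x = q2 y \<and> q3 x = q3 y"
  by (cases x; cases y) auto

instantiation quat :: real_vector
begin

definition "0 = Quat 0 0 0 0"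
definition "x + y = Quat (q0 x + q0 y) (q1 x + q1 y) (q2 x + q2 y) (q3 x + q3 y)"
definition "- x = Quat (- q0 x) (- q1 x) (- q2 x) (- q3 x)"
definition "x - y = Quat (q0 x - q0 y) (q1 x - q1 y) (q2 x - q2 y) (q3 x - q3 y)"
definition "r *\<^sub>R x = Quat (r * q0 x) (r * q1 x) (r * q2 x) (r * q3 x)"

instance
  by standard (simp_all add: zero_quat_def plus_quat_def uminus_quat_def minus_quat_def
    scaleR_quat_def quat_eq_iff algebra_simps)

end

instantiation quat :: real_inner
begin

definition "inner x y = q0 x * q0 y + q1 x * q1 y + q2 x * q2 y + q3 x * q3 y"
definition "norm (x :: quat) = sqrt (inner x x)"
definition "sgn (x :: quat) = x /\<^sub>R norm x"
definition "dist (x :: quat) y = norm (x - y)"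
definition "(uniformity :: (quat \<times> quat) filter) = (INF e\<in>{0 <..}. principal {(x, y). dist x y < e})"
definition "open (U :: quat set) \<longleftrightarrow> (\<forall>x\<in>U. eventually (\<lambda>(x', y). x' = x \<longrightarrow> y \<in> U) uniformity)"

instance
proof
  fix x :: quat
  show "0 \<le> inner x x"
    by (simp add: inner_quat_def)
  have x0: "x = 0 \<longleftrightarrow> q0 x = 0 \<and> q1 x = 0 \<and> q2 x = 0 \<and> q3 x = 0"
    by (simp add: quat_eq_iff zero_quat_def)
  show "inner x x = 0 \<longleftrightarrow> x = 0"
    unfolding x0 inner_quat_def by (smt (verit) mult_eq_0_iff zero_le_square)
qed (simp_all add: zero_quat_def plus_quat_def uminus_quat_def minus_quat_def scaleR_quat_def
    inner_quat_def norm_quat_def sgn_quat_def dist_quat_def uniformity_quat_def open_quat_def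
    quat_eq_iff algebra_simps)

end

lemma quat_sel [simp]:
  fixes x y :: quat
  shows "q0 0 = 0" "q1 0 = 0" "q2 0 = 0" "q3 0 = 0"
    "q0 (x + y) = q0 x + q0 y" "q1 (x + y) = q1 x + q1 y"
    "q2 (x + y) = q2 x + q2 y" "q3 (x + y) = q3 x + q3 y"
    "q0 (r *\<^sub>R x) = r * q0 x" "q1 (r *\<^sub>R x) = r * q1 x"
    "q2 (r *\<^sub>R x) = r * q2 x" "q3 (r *\<^sub>R x) = r * q3 x"
  by (simp_all add: zero_quat_def plus_quat_def scaleR_quat_def)

instantiation quat :: euclidean_space
begin

definition "Basis = {Quat 1 0 0 0, Quat 0 1 0 0, Quat 0 0 1 0, Quat 0 0 0 1}"

instance
proof
  show "(\<forall>u\<in>Basis. inner x u = 0) \<longleftrightarrow> x = 0" for x :: quat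
    unfolding quat_eq_iff[of x 0] by (simp add: Basis_quat_def inner_quat_def)
qed (auto simp: Basis_quat_def inner_quat_def)

end

instantiation quat :: real_normed_div_algebra
begin

definition "1 = Quat 1 0 0 0"

definition "x * y = Quat
  (q0 x * q0 y - q1 x * q1 y - q2 x * q2 y - q3 x * q3 y)
  (q0 x * q1 y + q1 x * q0 y + q2 x * q3 y - q3 x * q2 y)
  (q0 x * q2 y - q1 x * q3 y + q2 x * q0 y + q3 x * q1 y)
  (q0 x * q3 y + q1 x * q2 y - q2 x * q1 y + q3 x * q0 y)"

definition "inverse x = Quat (q0 x) (- q1 x) (- q2 x) (- q3 x) /\<^sub>R (inner x x)"

definition "x div (y :: quat) = x * inverse y"

instance
proof
  fix x y :: quat
  define c where "c = inverse (inner x x)"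
  have inv: "inverse x = Quat (c * q0 x) (- c * q1 x) (- c * q2 x) (- c * q3 x)"
    by (simp add: inverse_quat_def c_def scaleR_quat_def)
  have c: "c * (q0 x * q0 x + q1 x * q1 x + q2 x * q2 x + q3 x * q3 x) = 1" if "x \<noteq> 0"
  proof -
    have "c * inner x x = 1" using that by (simp add: c_def)
    then show ?thesis by (simp add: inner_quat_def)
  qed
  show "inverse x * x = 1" if "x \<noteq> 0"
    using c[OF that] by (simp add: inv times_quat_def one_quat_def quat_eq_iff algebra_simps)
  show "x * inverse x = 1" if "x \<noteq> 0"
    using c[OF that] by (simp add: inv times_quat_def one_quat_def quat_eq_iff algebra_simps)
  have "inner (x * y) (x * y) = inner x x * inner y y"
    by (simp add: inner_quat_def times_quat_def algebra_simps)
  then show "norm (x * y) = norm x * norm y"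
    by (simp add: norm_quat_def real_sqrt_mult)
  show "inverse (0 :: quat) = 0"
    by (simp add: inverse_quat_def quat_eq_iff)
qed (simp_all add: times_quat_def one_quat_def divide_quat_def quat_eq_iff algebra_simps)

end

instantiation quat :: hermitian_scalar
begin

definition "hconj x = Quat (q0 x) (- q1 x) (- q2 x) (- q3 x)"

instance
proof
  fix x y :: quat and r :: real
  show "hconj (r *\<^sub>R 1 :: quat) = r *\<^sub>R 1"
    by (simp add: hconj_quat_def one_quat_def quat_eq_iff)
  have n: "(norm x)\<^sup>2 = q0 x * q0 x + q1 x * q1 x + q2 x * q2 x + q3 x * q3 x"
    by (simp add: power2_norm_eq_inner inner_quat_def)
  show "hconj x * x = (norm x)\<^sup>2 *\<^sub>R 1"
    unfolding n by (simp only: hconj_quat_def one_quat_def times_quat_def scaleR_quat_def quat.sel) simp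
  show "hconj (x + y) = hconj x + hconj y"
    by (simp add: hconj_quat_def quat_eq_iff)
  show "hconj (hconj x) = x"
    by (simp add: hconj_quat_def quat_eq_iff)
  show "hconj (x * y) = hconj y * hconj x"
    by (simp only: hconj_quat_def times_quat_def quat.sel quat.inject) (simp add: algebra_simps)
qed

end


section \<open>Smooth maps\<close>

text \<open>
  \<open>C_k k U f\<close>: \<open>f\<close> is of class $C^k$ on \<open>U\<close>. It is used
  only for open \<open>U\<close> and for nondegenerate compact intervals, where the derivative
  within \<open>U\<close> is unique (one-sided at the end points of an interval).
\<close>

primrec C_k :: "nat \<Rightarrow> 'a::real_normed_vector set \<Rightarrow> ('a \<Rightarrow> 'b::real_normed_vector) \<Rightarrow> bool"
  where
    "C_k 0 U f \<longleftrightarrow> continuous_on U f"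
  | "C_k (Suc k) U f \<longleftrightarrow> f differentiable_on U \<and>
       (\<forall>h. C_k k U (\<lambda>x. frechet_derivative f (at x within U) h))"

definition smooth_on :: "'a::real_normed_vector set \<Rightarrow> ('a \<Rightarrow> 'b::real_normed_vector) \<Rightarrow> bool"
  where "smooth_on U f \<longleftrightarrow> (\<forall>k. C_k k U f)"


section \<open>Hermitian spaces and their projective spaces\<close>

text \<open>
  The trace of a real-linear endomorphism. It does not depend on the orthonormal basis, nor on
  the euclidean inner product, used to compute it.
\<close>

definition real_trace :: "('v::euclidean_space \<Rightarrow> 'v) \<Rightarrow> real"
  where "real_trace f = (\<Sum>b\<in>Basis. inner (f b) b)"

text \<open>
  The class \<open>euclidean_space\<close> of the type of vectors only says that it is a
  finite-dimensional real vector space with its usual topology; its positive definite inner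
  product is unrelated to the hermitian form.
\<close>

locale hermitian_space =
  fixes smul :: "'v::euclidean_space \<Rightarrow> 'k::hermitian_scalar \<Rightarrow> 'v"  (infixl \<open>\<cdot>\<close> 75)
    and form :: "'v \<Rightarrow> 'v \<Rightarrow> 'k"  (\<open>\<langle>_, _\<rangle>\<close>)
  assumes smul_add_left: "(u + v) \<cdot> k = u \<cdot> k + v \<cdot> k"
    and smul_add_right: "v \<cdot> (k + l) = v \<cdot> k + v \<cdot> l"
    and smul_mult: "v \<cdot> (k * l) = v \<cdot> k \<cdot> l"
    and smul_of_real: "v \<cdot> of_real r = r *\<^sub>R v"
    and form_add_left: "\<langle>u + v, w\<rangle> = \<langle>u, w\<rangle> + \<langle>v, w\<rangle>"
    and form_add_right: "\<langle>w, u + v\<rangle> = \<langle>w, u\<rangle> + \<langle>w, v\<rangle>"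
    and form_smul_left: "\<langle>u \<cdot> k, v\<rangle> = hconj k * \<langle>u, v\<rangle>"
    and form_smul_right: "\<langle>u, v \<cdot> k\<rangle> = \<langle>u, v\<rangle> * k"
    and form_hermitian: "\<langle>u, v\<rangle> = hconj \<langle>v, u\<rangle>"
    and form_nondegenerate: "(\<And>u. \<langle>u, v\<rangle> = 0) \<Longrightarrow> v = 0"
begin

text \<open>
  Points of the projective space are one-dimensional subspaces. Notions defined below through
  \<open>rep\<close> do not depend on the choice of the representative.
\<close>

definition pt :: "'v \<Rightarrow> 'v set"
  where "pt v = range (\<lambda>k. v \<cdot> k)"

definition proj_space :: "'v set set"
  where "proj_space = {pt v | v. v \<noteq> 0}"

definition rep :: "'v set \<Rightarrow> 'v"
  where "rep x = (SOME v. v \<in> x \<and> v \<noteq> 0)"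

definition orthogonal_pts :: "'v set \<Rightarrow> 'v set \<Rightarrow> bool"
  where "orthogonal_pts x y \<longleftrightarrow> \<langle>rep x, rep y\<rangle> = 0"

definition nonisotropic_vectors :: "'v set"
  where "nonisotropic_vectors = {v. \<langle>v, v\<rangle> \<noteq> 0}"

definition nonisotropic :: "'v set set"
  where "nonisotropic = {x \<in> proj_space. \<langle>rep x, rep x\<rangle> \<noteq> 0}"

definition Lin :: "('v \<Rightarrow> 'v) set"
  where "Lin = {f. (\<forall>u v. f (u + v) = f u + f v) \<and> (\<forall>v k. f (v \<cdot> k) = f v \<cdot> k)}"

definition pi' :: "'v set \<Rightarrow> 'v \<Rightarrow> 'v"
  where "pi' x v = rep x \<cdot> (\<langle>rep x, v\<rangle> / \<langle>rep x, rep x\<rangle>)"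

definition pi :: "'v set \<Rightarrow> 'v \<Rightarrow> 'v"
  where "pi x v = v - pi' x v"

text \<open>Tangent vectors, extended by zero to the orthogonal complement of the point.\<close>

definition tangent :: "'v set \<Rightarrow> ('v \<Rightarrow> 'v) set"
  where "tangent x = {t \<in> Lin. (\<forall>v. \<langle>rep x, v\<rangle> = 0 \<longrightarrow> t v = 0) \<and> (\<forall>v. \<langle>rep x, t v\<rangle> = 0)}"

definition tang :: "('v \<Rightarrow> 'v) \<Rightarrow> 'v set \<Rightarrow> 'v \<Rightarrow> 'v"
  where "tang t x = pi x \<circ> t \<circ> pi' x"

definition Eu :: "'v set \<Rightarrow> ('v \<Rightarrow> 'v) \<Rightarrow> 'v set \<Rightarrow> 'v \<Rightarrow> 'v"
  where "Eu p s x = (\<lambda>v. (1 / 2) *\<^sub>R tang (pi p \<circ> pi' x \<circ> s) x v + tang s x v)"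

definition adjoint_map :: "('v \<Rightarrow> 'v) \<Rightarrow> 'v \<Rightarrow> 'v"
  where "adjoint_map t = (THE s. \<forall>u v. \<langle>s u, v\<rangle> = \<langle>u, t v\<rangle>)"

text \<open>The parameter \<open>\<sigma>\<close> is the sign \<open>1\<close> or \<open>-1\<close>.\<close>

definition metric :: "real \<Rightarrow> ('v \<Rightarrow> 'v) \<Rightarrow> ('v \<Rightarrow> 'v) \<Rightarrow> real"
  where "metric \<sigma> t1 t2 = \<sigma> * (real_trace (adjoint_map t1 \<circ> t2) / real DIM('k))"


subsection \<open>Projective lines and geodesics\<close>

definition K_plane :: "'v set \<Rightarrow> bool"
  where "K_plane L \<longleftrightarrow> (\<exists>u v. (\<forall>k l. u \<cdot> k + v \<cdot> l = 0 \<longrightarrow> k = 0 \<and> l = 0)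
    \<and> L = {u \<cdot> k + v \<cdot> l | k l. True})"

text \<open>A projective line is identified with the corresponding two-dimensional subspace.\<close>

definition euclidean_line :: "'v set \<Rightarrow> bool"
  where "euclidean_line L \<longleftrightarrow> K_plane L \<and> (\<exists>u\<in>L. \<exists>v\<in>L. \<langle>u, v\<rangle> \<noteq> 0)
    \<and> (\<exists>u\<in>L. u \<noteq> 0 \<and> (\<forall>v\<in>L. \<langle>u, v\<rangle> = 0))"

definition line_through :: "'v set \<Rightarrow> 'v set \<Rightarrow> 'v set"
  where "line_through p q = {u + v | u v. u \<in> p \<and> v \<in> q}"

definition geodesic :: "'v set set \<Rightarrow> bool"
  where "geodesic C \<longleftrightarrow> (\<exists>W. subspace W \<and> dim W = 2
    \<and> (\<forall>u\<in>W. \<forall>v\<in>W. \<langle>u, v\<rangle> \<in> \<real>) \<and> (\<exists>u\<in>W. \<exists>v\<in>W. \<langle>u, v\<rangle> \<noteq> 0)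
    \<and> C = pt ` (W - {0}))"

text \<open>
  Smooth curves in the projective space are given by smooth lifts to nonzero vectors (over an
  interval such a lift always exists). A path without self-intersections which goes from
  \<open>p\<close> to \<open>q\<close> in a circle and avoids the point orthogonal to
  \<open>p\<close> runs once, in the positive direction, through the oriented segment
  \<open>G[p, q]\<close>.
\<close>

definition parametrizes_segment :: "'v set \<Rightarrow> 'v set \<Rightarrow> real \<Rightarrow> real \<Rightarrow> (real \<Rightarrow> 'v) \<Rightarrow> bool"
  where "parametrizes_segment p q a b \<gamma> \<longleftrightarrow> a < b \<and> smooth_on {a..b} \<gamma>
    \<and> (\<forall>s\<in>{a..b}. \<gamma> s \<noteq> 0) \<and> inj_on (\<lambda>s. pt (\<gamma> s)) {a..b}
    \<and> pt (\<gamma> a) = p \<and> pt (\<gamma> b) = q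
    \<and> (\<exists>C. geodesic C \<and> (\<forall>s\<in>{a..b}. pt (\<gamma> s) \<in> C))
    \<and> (\<forall>s\<in>{a..b}. \<not> orthogonal_pts p (pt (\<gamma> s)))"


subsection \<open>The Levi-Civita connection on the space of nonisotropic points\<close>

definition smooth_fun :: "('v set \<Rightarrow> real) \<Rightarrow> bool"
  where "smooth_fun f \<longleftrightarrow> smooth_on nonisotropic_vectors (\<lambda>v. f (pt v))"

definition vector_field :: "('v set \<Rightarrow> 'v \<Rightarrow> 'v) \<Rightarrow> bool"
  where "vector_field X \<longleftrightarrow> (\<forall>x\<in>nonisotropic. X x \<in> tangent x)
    \<and> (\<forall>u. smooth_on nonisotropic_vectors (\<lambda>v. X (pt v) u))"

text \<open>
  The action of a tangent vector \<open>t\<close> at \<open>x\<close> on functions: the derivative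
  of the lift of \<open>f\<close> at \<open>x\<close> in the direction \<open>t x\<close>.
\<close>

definition deriv_along :: "'v set \<Rightarrow> ('v \<Rightarrow> 'v) \<Rightarrow> ('v set \<Rightarrow> real) \<Rightarrow> real"
  where "deriv_along x t f = frechet_derivative (\<lambda>v. f (pt v)) (at (rep x)) (t (rep x))"

text \<open>
  \<open>nabla X Y\<close> is the covariant derivative of \<open>Y\<close> along \<open>X\<close>.
  The conditions are: it is a vector field; it is linear over functions in \<open>X\<close>;
  additivity and the Leibniz rule in \<open>Y\<close>; vanishing torsion; compatibility with the
  metric. Values outside the nonisotropic points are irrelevant.
\<close>

definition levi_civita ::
  "real \<Rightarrow> (('v set \<Rightarrow> 'v \<Rightarrow> 'v) \<Rightarrow> ('v set \<Rightarrow> 'v \<Rightarrow> 'v) \<Rightarrow> ('v set \<Rightarrow> 'v \<Rightarrow> 'v)) \<Rightarrow> bool"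
  where "levi_civita \<sigma> nabla \<longleftrightarrow>
    (\<forall>X Y. vector_field X \<longrightarrow> vector_field Y \<longrightarrow> vector_field (nabla X Y)) \<and>
    (\<forall>X X' Y. vector_field X \<longrightarrow> vector_field X' \<longrightarrow> vector_field Y \<longrightarrow>
      (\<forall>x\<in>nonisotropic. \<forall>v. nabla (\<lambda>z w. X z w + X' z w) Y x v = nabla X Y x v + nabla X' Y x v)) \<and>
    (\<forall>f X Y. smooth_fun f \<longrightarrow> vector_field X \<longrightarrow> vector_field Y \<longrightarrow>
      (\<forall>x\<in>nonisotropic. \<forall>v. nabla (\<lambda>z w. f z *\<^sub>R X z w) Y x v = f x *\<^sub>R nabla X Y x v)) \<and>
    (\<forall>X Y Y'. vector_field X \<longrightarrow> vector_field Y \<longrightarrow> vector_field Y' \<longrightarrow>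
      (\<forall>x\<in>nonisotropic. \<forall>v. nabla X (\<lambda>z w. Y z w + Y' z w) x v = nabla X Y x v + nabla X Y' x v)) \<and>
    (\<forall>f X Y. smooth_fun f \<longrightarrow> vector_field X \<longrightarrow> vector_field Y \<longrightarrow>
      (\<forall>x\<in>nonisotropic. \<forall>v. nabla X (\<lambda>z w. f z *\<^sub>R Y z w) x v =
        deriv_along x (X x) f *\<^sub>R Y x v + f x *\<^sub>R nabla X Y x v)) \<and>
    (\<forall>X Y f. vector_field X \<longrightarrow> vector_field Y \<longrightarrow> smooth_fun f \<longrightarrow>
      (\<forall>x\<in>nonisotropic. deriv_along x (\<lambda>v. nabla X Y x v - nabla Y X x v) f =
        deriv_along x (X x) (\<lambda>z. deriv_along z (Y z) f)
        - deriv_along x (Y x) (\<lambda>z. deriv_along z (X z) f))) \<and>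
    (\<forall>X Y Z. vector_field X \<longrightarrow> vector_field Y \<longrightarrow> vector_field Z \<longrightarrow>
      (\<forall>x\<in>nonisotropic. deriv_along x (X x) (\<lambda>z. metric \<sigma> (Y z) (Z z)) =
        metric \<sigma> (nabla X Y x) (Z x) + metric \<sigma> (Y x) (nabla X Z x)))"


subsection \<open>Parallel transport\<close>

text \<open>
  The velocity of the curve \<open>pt \<circ> \<gamma>\<close>: the tangent vector that sends
  \<open>\<gamma> s\<close> to the component of \<open>\<gamma>' s\<close> orthogonal to
  \<open>\<gamma> s\<close>.
\<close>

definition velocity :: "real \<Rightarrow> real \<Rightarrow> (real \<Rightarrow> 'v) \<Rightarrow> real \<Rightarrow> 'v \<Rightarrow> 'v"
  where "velocity a b \<gamma> s = (\<lambda>v. pi (pt (\<gamma> s)) (vector_derivative \<gamma> (at s within {a..b}))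
    \<cdot> (\<langle>\<gamma> s, v\<rangle> / \<langle>\<gamma> s, \<gamma> s\<rangle>))"

text \<open>
  The covariant derivative at \<open>s\<close> of a field \<open>T\<close> of tangent vectors
  along \<open>pt \<circ> \<gamma>\<close>. If \<open>T\<close> is a combination of restrictions of
  vector fields \<open>X j\<close> with coefficients \<open>c j\<close>, then by the Leibniz rule the
  covariant derivative is the sum of the terms
  \<open>c j' X j + c j nabla\<^bsub>Y\<^esub> (X j)\<close>, where \<open>Y\<close> extends the
  velocity at \<open>s\<close>. Every differentiable \<open>T\<close> is such a combination: expand
  \<open>T s = tang (T s) (pt (\<gamma> s))\<close> with respect to a real basis of
  \<open>Lin\<close>.
\<close>

definition has_covariant_derivative ::
  "(('v set \<Rightarrow> 'v \<Rightarrow> 'v) \<Rightarrow> ('v set \<Rightarrow> 'v \<Rightarrow> 'v) \<Rightarrow> ('v set \<Rightarrow> 'v \<Rightarrow> 'v)) \<Rightarrow>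
    real \<Rightarrow> real \<Rightarrow> (real \<Rightarrow> 'v) \<Rightarrow> (real \<Rightarrow> 'v \<Rightarrow> 'v) \<Rightarrow> ('v \<Rightarrow> 'v) \<Rightarrow> real \<Rightarrow> bool"
  where "has_covariant_derivative nabla a b \<gamma> T D s \<longleftrightarrow>
    (\<exists>(n::nat) X c c' Y.
      (\<forall>j<n. vector_field (X j) \<and> (c j has_real_derivative c' j) (at s within {a..b})) \<and>
      (\<forall>r\<in>{a..b}. \<forall>v. T r v = (\<Sum>j<n. c j r *\<^sub>R X j (pt (\<gamma> r)) v)) \<and>
      vector_field Y \<and> Y (pt (\<gamma> s)) = velocity a b \<gamma> s \<and>
      (\<forall>v. D v = (\<Sum>j<n. c' j *\<^sub>R X j (pt (\<gamma> s)) v + c j s *\<^sub>R nabla Y (X j) (pt (\<gamma> s)) v)))"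

definition parallel_along where
  "parallel_along nabla a b \<gamma> T \<longleftrightarrow> (\<forall>s\<in>{a..b}. T s \<in> tangent (pt (\<gamma> s))
    \<and> has_covariant_derivative nabla a b \<gamma> T (\<lambda>v. 0) s)"

text \<open>\<open>t'\<close> is the parallel transport of \<open>t\<close> along the curve.\<close>

definition is_parallel_transport where
  "is_parallel_transport nabla a b \<gamma> t t' \<longleftrightarrow>
    (\<exists>T. parallel_along nabla a b \<gamma> T \<and> T a = t \<and> T b = t')"

end

end

theory Submission
  imports Defs
begin

text \<open>
  The idea is to make the Levi-Civita connection explicit and then to solve the equation of
  parallel transport, which on a euclidean line can be integrated by hand.

  The connection. A vector field \<open>Y\<close> lifts to a map from nonisotropic vectors to linear
  endomorphisms of the fixed vector space \<open>V\<close>, which can be differentiated there. Projecting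
  that derivative back to the tangent space gives a connection, called \<open>flat_connection\<close>
  below. It is torsion-free and compatible with the metric, hence equal to every Levi-Civita
  connection: the difference of the two is symmetric in \<open>X\<close>, \<open>Y\<close> and, paired with
  \<open>Z\<close>, skew in \<open>Y\<close>, \<open>Z\<close>, so it vanishes (\<open>levi_civita_eq_flat_connection\<close>). The torsion
  identity only has to be tested on the components of the matrix-valued function that assigns to a
  point the orthogonal projection onto it; their derivative along a tangent vector recovers that
  vector.

  Consequently a field \<open>T\<close> along a curve with lift \<open>\<gamma>\<close> is parallel iff the
  derivative of \<open>T\<close> as a curve of endomorphisms of \<open>V\<close>, evaluated at
  \<open>\<gamma>\<close>, is a multiple of \<open>\<gamma>\<close> (\<open>parallel_along_iff\<close>).

  The euclidean line. If \<open>p\<close> and \<open>q\<close> span a euclidean line, representatives can be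
  chosen with \<open>q = p + u\<close>, where \<open>u\<close> spans the kernel of the form on the line, and the
  geodesic segment is \<open>\<delta> = p + f u\<close> with a real function \<open>f\<close> running from 0 to 1
  (\<open>geodesic_on_euclidean_line\<close>). Write \<open>w = T \<delta>\<close>. Parallelism says that
  \<open>w'\<close> is a multiple of \<open>\<delta>\<close>. Since \<open>u\<close> is orthogonal to \<open>\<delta>\<close>,
  the scalar \<open>c = \<langle>u, w\<rangle>\<close> is constant, and differentiating
  \<open>\<langle>\<delta>, w\<rangle> = 0\<close> gives \<open>\<langle>\<delta>, w'\<rangle> = - f' c\<close>. As
  \<open>\<langle>\<delta>, \<delta>\<rangle> = \<langle>p, p\<rangle>\<close>, the equation becomes
  \<open>w' = - \<delta> f' c / \<langle>p, p\<rangle>\<close>, whose right-hand side is explicit. Its integral from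
  \<open>f = 0\<close> to \<open>f = 1\<close> is \<open>- (p + u / 2) c / \<langle>p, p\<rangle>\<close>
  (\<open>parallel_transport_on_euclidean_line\<close>), and \<open>Eu\<close> takes the same value: the term
  \<open>t\<^sub>q\<close> contributes \<open>- (p + u) c / \<langle>p, p\<rangle>\<close>, the other one
  \<open>u c / (2 \<langle>p, p\<rangle>)\<close> (\<open>Eu_on_euclidean_line\<close>).
\<close>

section \<open>Calculus of smooth maps\<close>

lemma frechet_derivative_cong_on:
  assumes "\<And>x. x \<in> U \<Longrightarrow> f x = g x" "x \<in> U"
  shows "frechet_derivative f (at x within U) = frechet_derivative g (at x within U)"
proof -
  have "(f has_derivative D) (at x within U) \<longleftrightarrow> (g has_derivative D) (at x within U)" for D
    using assms by (metis has_derivative_transform)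
  then show ?thesis by (simp add: frechet_derivative_def)
qed

lemma C_k_cong:
  assumes "\<And>x. x \<in> U \<Longrightarrow> f x = g x" "C_k k U f"
  shows "C_k k U g"
  using assms
proof (induction k arbitrary: f g)
  case 0
  then show ?case by (simp cong: continuous_on_cong)
next
  case (Suc k)
  have "f differentiable_on U"
    using Suc.prems by simp
  then have "g differentiable_on U"
    unfolding differentiable_on_def differentiable_def
    using has_derivative_transform[of _ U g f] Suc.prems(1) by metis
  moreover have "C_k k U (\<lambda>x. frechet_derivative g (at x within U) h)" for h
  proof (rule Suc.IH)
    show "C_k k U (\<lambda>x. frechet_derivative f (at x within U) h)"
      using Suc.prems by simp
  next
    fix x assume x: "x \<in> U"
    show "frechet_derivative f (at x within U) h = frechet_derivative g (at x within U) h"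
      using frechet_derivative_cong_on[of U f g, OF Suc.prems(1) x] by simp
  qed
  ultimately show ?case by simp
qed

lemma C_k_SucI:
  assumes "open U" "\<And>x. x \<in> U \<Longrightarrow> (f has_derivative f' x) (at x)"
    and "\<And>h. C_k k U (\<lambda>x. f' x h)"
  shows "C_k (Suc k) U f"
proof -
  have "frechet_derivative f (at x within U) = f' x" if "x \<in> U" for x
    using assms(1,2) that by (metis at_within_open frechet_derivative_at)
  then have "C_k k U (\<lambda>x. frechet_derivative f (at x within U) h)" for h
    using C_k_cong[OF _ assms(3)[of h]] by simp
  then show ?thesis
    using assms(2) by (auto simp: differentiable_on_def differentiable_def intro: has_derivative_at_withinI)
qed

text \<open>
  Together with the previous lemma this lets the closure properties below be proved by
  induction on the order, using any convenient form of the derivative.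
\<close>
lemma C_k_SucE:
  assumes "open U" "C_k (Suc k) U f"
  shows "\<exists>f'. (\<forall>x\<in>U. (f has_derivative f' x) (at x)) \<and> (\<forall>h. C_k k U (\<lambda>x. f' x h))"
proof (intro exI conjI ballI allI)
  show "(f has_derivative frechet_derivative f (at x within U)) (at x)" if "x \<in> U" for x
    using assms that unfolding C_k.simps differentiable_on_def
    by (metis at_within_open frechet_derivative_works)
qed (use assms in simp)

lemma C_k_Suc_imp: "C_k (Suc k) U f \<Longrightarrow> C_k k U f"
proof (induction k arbitrary: f)
  case 0
  then show ?case by (simp add: differentiable_imp_continuous_on)
next
  case (Suc k)
  then have "f differentiable_on U" "\<And>h. C_k (Suc k) U (\<lambda>x. frechet_derivative f (at x within U) h)"
    using C_k.simps(2)[of "Suc k" U f] by blast+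
  then show ?case
    using C_k.simps(2)[of k U f] Suc.IH by blast
qed

lemma C_k_const: "open U \<Longrightarrow> C_k k U (\<lambda>x. c)"
proof (induction k arbitrary: c)
  case (Suc k)
  show ?case
    by (rule C_k_SucI[where f' = "\<lambda>_ _. 0"]) (use Suc in auto)
qed simp

lemma C_k_add: "open U \<Longrightarrow> C_k k U f \<Longrightarrow> C_k k U g \<Longrightarrow> C_k k U (\<lambda>x. f x + g x)"
proof (induction k arbitrary: f g)
  case 0
  then show ?case by (simp add: continuous_on_add)
next
  case (Suc k)
  obtain f' where f': "\<And>x. x \<in> U \<Longrightarrow> (f has_derivative f' x) (at x)" "\<And>h. C_k k U (\<lambda>x. f' x h)"
    using C_k_SucE[OF Suc.prems(1,2)] by blast
  obtain g' where g': "\<And>x. x \<in> U \<Longrightarrow> (g has_derivative g' x) (at x)" "\<And>h. C_k k U (\<lambda>x. g' x h)"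
    using C_k_SucE[OF Suc.prems(1,3)] by blast
  show ?case
    by (rule C_k_SucI[where f' = "\<lambda>x h. f' x h + g' x h"])
      (use Suc f' g' in \<open>auto intro: has_derivative_add\<close>)
qed

lemma C_k_bounded_linear: "open U \<Longrightarrow> bounded_linear L \<Longrightarrow> C_k k U L"
proof (induction k)
  case 0
  then show ?case by (simp add: linear_continuous_on)
next
  case (Suc k)
  show ?case
    by (rule C_k_SucI[where f' = "\<lambda>x. L"])
      (use Suc in \<open>auto intro: bounded_linear_imp_has_derivative C_k_const\<close>)
qed

lemma (in bounded_bilinear) C_k:
  "open U \<Longrightarrow> C_k k U f \<Longrightarrow> C_k k U g \<Longrightarrow> C_k k U (\<lambda>x. prod (f x) (g x))"
proof (induction k arbitrary: f g)
  case 0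
  then show ?case by (simp add: continuous_on)
next
  case (Suc k)
  obtain f' where f': "\<And>x. x \<in> U \<Longrightarrow> (f has_derivative f' x) (at x)" "\<And>h. C_k k U (\<lambda>x. f' x h)"
    using C_k_SucE[OF Suc.prems(1,2)] by blast
  obtain g' where g': "\<And>x. x \<in> U \<Longrightarrow> (g has_derivative g' x) (at x)" "\<And>h. C_k k U (\<lambda>x. g' x h)"
    using C_k_SucE[OF Suc.prems(1,3)] by blast
  show ?case
  proof (rule C_k_SucI[where f' = "\<lambda>x h. prod (f x) (g' x h) + prod (f' x h) (g x)"])
    show "C_k k U (\<lambda>x. prod (f x) (g' x h) + prod (f' x h) (g x))" for h
      using Suc.prems(1) Suc.prems(2,3)[THEN C_k_Suc_imp] f'(2) g'(2) by (intro C_k_add Suc.IH)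
  qed (use Suc.prems FDERIV[OF f'(1) g'(1)] in auto)
qed

text \<open>
  The derivative of the inverse is the product of two copies of the inverse with the derivative of
  the function; by the induction hypothesis all three factors are of the lower class.
\<close>
lemma C_k_inverse:
  fixes f :: "'a::real_normed_vector \<Rightarrow> real"
  shows "open U \<Longrightarrow> C_k k U f \<Longrightarrow> (\<And>x. x \<in> U \<Longrightarrow> f x \<noteq> 0) \<Longrightarrow> C_k k U (\<lambda>x. inverse (f x))"
proof (induction k)
  case 0
  then show ?case by (simp add: continuous_on_inverse)
next
  case (Suc k)
  obtain f' where f': "\<And>x. x \<in> U \<Longrightarrow> (f has_derivative f' x) (at x)" "\<And>h. C_k k U (\<lambda>x. f' x h)"
    using C_k_SucE[OF Suc.prems(1,2)] by blast
  have inv: "C_k k U (\<lambda>x. inverse (f x))"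
    using Suc C_k_Suc_imp by blast
  show ?case
  proof (rule C_k_SucI[where f' = "\<lambda>x h. - 1 * (inverse (f x) * f' x h * inverse (f x))"])
    show "C_k k U (\<lambda>x. - 1 * (inverse (f x) * f' x h * inverse (f x)))" for h
      using Suc.prems(1) inv f'(2)
      by (intro bounded_bilinear.C_k[OF bounded_bilinear_mult] C_k_const)
  qed (use Suc.prems f' in \<open>auto intro!: derivative_eq_intros\<close>)
qed

lemma smooth_on_const: "open U \<Longrightarrow> smooth_on U (\<lambda>x. c)"
  by (simp add: smooth_on_def C_k_const)

lemma smooth_on_add: "open U \<Longrightarrow> smooth_on U f \<Longrightarrow> smooth_on U g \<Longrightarrow> smooth_on U (\<lambda>x. f x + g x)"
  by (simp add: smooth_on_def C_k_add)

lemma smooth_on_bounded_linear: "open U \<Longrightarrow> bounded_linear L \<Longrightarrow> smooth_on U L"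
  by (simp add: smooth_on_def C_k_bounded_linear)

lemma (in bounded_bilinear) smooth_on:
  "open U \<Longrightarrow> smooth_on U f \<Longrightarrow> smooth_on U g \<Longrightarrow> smooth_on U (\<lambda>x. prod (f x) (g x))"
  by (simp add: smooth_on_def C_k)

lemma smooth_on_inverse:
  fixes f :: "'a::real_normed_vector \<Rightarrow> real"
  shows "open U \<Longrightarrow> smooth_on U f \<Longrightarrow> (\<And>x. x \<in> U \<Longrightarrow> f x \<noteq> 0) \<Longrightarrow> smooth_on U (\<lambda>x. inverse (f x))"
  by (simp add: smooth_on_def C_k_inverse)

lemma smooth_on_cong: "(\<And>x. x \<in> U \<Longrightarrow> f x = g x) \<Longrightarrow> smooth_on U f \<Longrightarrow> smooth_on U g"
  unfolding smooth_on_def using C_k_cong[of U f g] by blast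

lemma smooth_on_imp_differentiable:
  "open U \<Longrightarrow> smooth_on U f \<Longrightarrow> x \<in> U \<Longrightarrow> f differentiable (at x)"
  using C_k.simps(2)[of 0 U f] at_within_open[of x U]
  unfolding smooth_on_def differentiable_on_def by auto

lemma vector_derivative_unique_interval:
  fixes f :: "real \<Rightarrow> 'a::real_normed_vector"
  assumes "a < b" "x \<in> {a..b}"
    and "(f has_vector_derivative f') (at x within {a..b})" "(f has_vector_derivative f'') (at x within {a..b})"
  shows "f' = f''"
  using vector_derivative_unique_within_closed_interval[of a b x f f' f''] assms by (simp add: cbox_interval)

lemma has_vector_derivative_zero_interval:
  fixes f :: "real \<Rightarrow> 'a::real_normed_vector"
  assumes "\<And>x. x \<in> {a..b} \<Longrightarrow> (f has_vector_derivative 0) (at x within {a..b})"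
    and "x \<in> {a..b}" "y \<in> {a..b}"
  shows "f x = f y"
  by (rule has_derivative_zero_unique[where s = "{a..b}"])
    (use assms in \<open>auto simp: has_vector_derivative_def\<close>)

section \<open>The scalars\<close>

lemma hconj_scaleR: "hconj (r *\<^sub>R x) = r *\<^sub>R hconj (x::'k::hermitian_scalar)"
  using hconj_mult[of "r *\<^sub>R 1" x] by (simp add: hconj_scaleR_1)

text \<open>
  Polarization of \<open>hconj x * x = (norm x)\<^sup>2\<close> at \<open>x\<close> and \<open>1\<close>. It shows
  that the real part of a scalar is its inner product with \<open>1\<close>, which is how real parts are
  written throughout.
\<close>
lemma hconj_plus_self: "x + hconj x = (2 * inner x 1) *\<^sub>R (1::'k::hermitian_scalar)"
proof -
  have one: "hconj (1::'k) = 1" using hconj_scaleR_1[of 1] by simp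
  have "hconj (x + 1) * (x + 1) = (norm (x + 1))\<^sup>2 *\<^sub>R 1"
    by (rule hconj_mult_self)
  moreover have "(norm (x + 1))\<^sup>2 = (norm x)\<^sup>2 + 1 + 2 * inner x 1"
    by (simp add: power2_norm_eq_inner inner_add_left inner_add_right inner_commute norm_eq_1[symmetric])
  ultimately show ?thesis
    using hconj_mult_self[of x] by (simp add: hconj_add one algebra_simps)
qed

lemma inner_one_one [simp]: "inner 1 (1::'k::hermitian_scalar) = 1"
  by (simp add: norm_eq_1[symmetric])

lemma inner_hconj_one: "inner (hconj x) 1 = inner (x::'k::hermitian_scalar) 1"
  using arg_cong[OF hconj_plus_self[of x], of "\<lambda>y. inner y 1"] by (simp add: inner_add_left)

lemma hconj_fixed: "hconj x = x \<Longrightarrow> x = inner x 1 *\<^sub>R (1::'k::hermitian_scalar)"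
proof -
  assume "hconj x = x"
  then have "2 *\<^sub>R x = 2 *\<^sub>R (inner x 1 *\<^sub>R 1)"
    using hconj_plus_self[of x] by (simp add: scaleR_2)
  then show ?thesis by (simp only: scaleR_cancel_left) simp
qed

lemma norm_hconj: "norm (hconj x) = norm (x::'k::hermitian_scalar)"
  using arg_cong[OF hconj_mult_self[of x], of norm]
  by (cases "x = 0") (use hconj_scaleR[of 0 x] in \<open>auto simp: norm_mult power2_eq_square\<close>)

lemma mult_hconj_self: "x * hconj x = (norm x)\<^sup>2 *\<^sub>R (1::'k::hermitian_scalar)"
  using hconj_mult_self[of "hconj x"] by (simp add: hconj_hconj norm_hconj)

text \<open>
  Polarization of the multiplicativity of the norm.
\<close>
lemma inner_mult_right_cancel:
  "inner (x * z) (y * z) = inner x y * (norm (z::'k::hermitian_scalar))\<^sup>2"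
proof -
  have n: "inner (w * z) (w * z) = inner w w * (norm z)\<^sup>2" for w
    by (simp add: power2_norm_eq_inner[symmetric] norm_mult power_mult_distrib)
  from n[of "x + y"] n[of x] n[of y] show ?thesis
    by (simp add: distrib_right inner_add_left inner_add_right inner_commute)
qed

text \<open>
  Right multiplication by a unit basis element is an isometry, so every basis element
  contributes the same amount.
\<close>
lemma trace_left_mult:
  "real_trace (\<lambda>k. c * k) = real DIM('k) * inner c (1::'k::hermitian_scalar)"
proof -
  have "inner (c * e) e = inner c 1" if "e \<in> Basis" for e :: 'k
    using inner_mult_right_cancel[of c e 1] that by simp
  then show ?thesis by (simp add: real_trace_def)
qed

lemma real_trace_compose:
  fixes f :: "'w::euclidean_space \<Rightarrow> 'v::euclidean_space" and g :: "'v \<Rightarrow> 'w"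
  assumes "linear f" "linear g"
  shows "real_trace (f \<circ> g) = real_trace (g \<circ> f)"
proof -
  have "inner (f (g b)) b = (\<Sum>e\<in>Basis. inner (g b) e * inner (f e) b)" for b
  proof -
    have "f (g b) = f (\<Sum>e\<in>Basis. inner (g b) e *\<^sub>R e)"
      by (simp add: euclidean_representation)
    also have "\<dots> = (\<Sum>e\<in>Basis. inner (g b) e *\<^sub>R f e)"
      using assms(1) by (simp add: linear_sum linear_scale)
    finally show ?thesis by (simp add: inner_sum_left)
  qed
  note fg = this
  have "inner (g (f e)) e = (\<Sum>b\<in>Basis. inner (g b) e * inner (f e) b)" for e
  proof -
    have "g (f e) = g (\<Sum>b\<in>Basis. inner (f e) b *\<^sub>R b)"
      by (simp add: euclidean_representation)
    also have "\<dots> = (\<Sum>b\<in>Basis. inner (f e) b *\<^sub>R g b)"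
      using assms(2) by (simp add: linear_sum linear_scale)
    finally show ?thesis by (simp add: inner_sum_left mult.commute)
  qed
  note gf = this
  have "real_trace (f \<circ> g) = (\<Sum>b\<in>Basis. \<Sum>e\<in>Basis. inner (g b) e * inner (f e) b)"
    unfolding real_trace_def comp_def using fg by (rule sum.cong[OF refl])
  also have "\<dots> = (\<Sum>e\<in>Basis. \<Sum>b\<in>Basis. inner (g b) e * inner (f e) b)"
    by (rule sum.swap)
  also have "\<dots> = real_trace (g \<circ> f)"
    unfolding real_trace_def comp_def using gf[symmetric] by (rule sum.cong[OF refl])
  finally show ?thesis .
qed

section \<open>Hermitian spaces and representatives of points\<close>

context hermitian_space
begin

lemma smul_one [simp]: "v \<cdot> 1 = v"
  using smul_of_real[of v 1] by simp

lemma smul_scaleR_right: "v \<cdot> (r *\<^sub>R k) = r *\<^sub>R (v \<cdot> k)"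
proof -
  have "v \<cdot> (r *\<^sub>R k) = v \<cdot> (k * of_real r)"
    by (simp add: of_real_def)
  then show ?thesis by (simp only: smul_mult smul_of_real)
qed

lemma smul_scaleR_left: "(r *\<^sub>R v) \<cdot> k = r *\<^sub>R (v \<cdot> k)"
proof -
  have "(r *\<^sub>R v) \<cdot> k = v \<cdot> (of_real r * k)"
    by (simp only: smul_mult smul_of_real)
  then show ?thesis by (simp add: scaleR_conv_of_real[symmetric] smul_scaleR_right)
qed

lemma form_scaleR_right: "\<langle>u, r *\<^sub>R v\<rangle> = r *\<^sub>R \<langle>u, v\<rangle>"
  using form_smul_right[of u v "of_real r"] by (simp only: smul_of_real) (simp add: of_real_def)

lemma form_scaleR_left: "\<langle>r *\<^sub>R u, v\<rangle> = r *\<^sub>R \<langle>u, v\<rangle>"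
  using form_hermitian form_scaleR_right hconj_scaleR by metis

sublocale smul: bounded_bilinear "(\<cdot>)"
  by (subst bilinear_conv_bounded_bilinear[symmetric])
    (auto simp: bilinear_def smul_add_left smul_add_right smul_scaleR_left smul_scaleR_right intro!: linearI)

sublocale form: bounded_bilinear form
  by (subst bilinear_conv_bounded_bilinear[symmetric])
    (auto simp: bilinear_def form_add_left form_add_right form_scaleR_left form_scaleR_right intro!: linearI)

text \<open>
  The real part of the hermitian form, a real symmetric bilinear form which is still
  nondegenerate.
\<close>
definition re_form :: "'v \<Rightarrow> 'v \<Rightarrow> real"
  where "re_form u v = inner \<langle>u, v\<rangle> 1"

definition quad :: "'v \<Rightarrow> real"
  where "quad v = re_form v v"

sublocale re_form: bounded_bilinear re_form
  by (subst bilinear_conv_bounded_bilinear[symmetric])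
    (auto simp: bilinear_def re_form_def form_add_left form_add_right form_scaleR_left form_scaleR_right
      inner_add_left intro!: linearI)

lemma form_self: "\<langle>v, v\<rangle> = quad v *\<^sub>R 1"
  unfolding quad_def re_form_def by (rule hconj_fixed) (rule form_hermitian[symmetric])

lemma re_form_commute: "re_form u v = re_form v u"
  unfolding re_form_def by (subst form_hermitian) (rule inner_hconj_one)

lemma form_eq_0_commute: "\<langle>u, v\<rangle> = 0 \<longleftrightarrow> \<langle>v, u\<rangle> = 0"
  by (metis form_hermitian norm_eq_zero norm_hconj)

text \<open>
  Testing against \<open>e \<cdot> hconj \<langle>w, e\<rangle>\<close> turns the real part into the squared norm of
  \<open>\<langle>w, e\<rangle>\<close>.
\<close>
lemma re_form_nondegenerate:
  assumes "\<And>e. re_form w e = 0"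
  shows "w = 0"
proof (rule form_nondegenerate)
  fix e
  have "re_form w (e \<cdot> hconj \<langle>w, e\<rangle>) = (norm \<langle>w, e\<rangle>)\<^sup>2"
    by (simp add: re_form_def form_smul_right mult_hconj_self)
  then have "\<langle>w, e\<rangle> = 0" using assms by simp
  then show "\<langle>e, w\<rangle> = 0" by (simp add: form_eq_0_commute)
qed

lemma nonisotropic_vectors_iff: "v \<in> nonisotropic_vectors \<longleftrightarrow> quad v \<noteq> 0"
  by (simp add: nonisotropic_vectors_def form_self)

lemma quad_nonzero_imp: "quad v \<noteq> 0 \<Longrightarrow> v \<noteq> 0"
  by (auto simp: quad_def re_form.zero_left)

lemma open_nonisotropic_vectors: "open nonisotropic_vectors"
proof -
  have "continuous_on UNIV quad"
    unfolding quad_def by (rule re_form.continuous_on) (rule continuous_on_id)+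
  then have "open (quad -` (- {0}))"
    by (intro open_vimage) auto
  also have "quad -` (- {0}) = nonisotropic_vectors"
    by (auto simp: nonisotropic_vectors_iff)
  finally show ?thesis .
qed

lemma quad_smul: "quad (v \<cdot> k) = (norm k)\<^sup>2 * quad v"
proof -
  have "\<langle>v \<cdot> k, v \<cdot> k\<rangle> = quad v *\<^sub>R (hconj k * k)"
    by (simp only: form_smul_left form_smul_right form_self[of v]) simp
  then show ?thesis
    by (simp add: quad_def[of "v \<cdot> k"] re_form_def hconj_mult_self)
qed

lemma smul_eq_0_iff: "v \<cdot> k = 0 \<longleftrightarrow> v = 0 \<or> k = 0"
proof -
  have "v = v \<cdot> k \<cdot> inverse k" if "k \<noteq> 0"
    using that by (simp add: smul_mult[symmetric])
  then show ?thesis by (metis smul.zero_left smul.zero_right)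
qed

lemma pt_smul: "k \<noteq> 0 \<Longrightarrow> pt (v \<cdot> k) = pt v"
proof -
  assume k: "k \<noteq> 0"
  have "v \<cdot> l = v \<cdot> k \<cdot> (inverse k * l)" for l
    using k by (simp add: smul_mult[symmetric] mult.assoc[symmetric])
  moreover have "v \<cdot> k \<cdot> l = v \<cdot> (k * l)" for l
    by (simp add: smul_mult)
  ultimately show ?thesis
    unfolding pt_def by (auto intro: rev_image_eqI) 
qed

lemma mem_pt_self: "v \<in> pt v"
  unfolding pt_def by (metis rangeI smul_one)

lemma pt_eq_pt_iff:
  assumes "v \<noteq> 0" "w \<noteq> 0"
  shows "pt v = pt w \<longleftrightarrow> (\<exists>k. k \<noteq> 0 \<and> w = v \<cdot> k)"
proof
  assume "pt v = pt w"
  then have "w \<in> pt v" using mem_pt_self by simp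
  then show "\<exists>k. k \<noteq> 0 \<and> w = v \<cdot> k"
    using assms(2) by (auto simp: pt_def smul_eq_0_iff)
qed (auto simp: pt_smul)

lemma rep_pt:
  assumes "v \<noteq> 0"
  obtains k where "k \<noteq> 0" "rep (pt v) = v \<cdot> k"
proof -
  have "rep (pt v) \<in> pt v \<and> rep (pt v) \<noteq> 0"
    unfolding rep_def using mem_pt_self assms by (metis (mono_tags, lifting) someI_ex)
  then obtain k where "rep (pt v) = v \<cdot> k" "v \<cdot> k \<noteq> 0"
    by (metis pt_def rangeE)
  then show thesis
    using that by (auto simp: smul_eq_0_iff)
qed

lemma pt_in_nonisotropic: "quad v \<noteq> 0 \<Longrightarrow> pt v \<in> nonisotropic"
proof -
  assume q: "quad v \<noteq> 0"
  then obtain k where k: "k \<noteq> 0" "rep (pt v) = v \<cdot> k"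
    using rep_pt quad_nonzero_imp by blast
  then show ?thesis
    using q quad_nonzero_imp[OF q] by (auto simp: nonisotropic_def proj_space_def form_self quad_smul)
qed

lemma nonisotropicE:
  assumes "x \<in> nonisotropic"
  obtains v where "x = pt v" "quad v \<noteq> 0"
proof -
  obtain v where v: "x = pt v" "v \<noteq> 0" "\<langle>rep x, rep x\<rangle> \<noteq> 0"
    using assms by (auto simp: nonisotropic_def proj_space_def)
  obtain k where "k \<noteq> 0" "rep (pt v) = v \<cdot> k"
    using rep_pt v(2) by blast
  then show thesis
    using v that[of v] by (simp add: form_self quad_smul)
qed

lemma orthogonal_pts_pt:
  assumes "v \<noteq> 0" "w \<noteq> 0"
  shows "orthogonal_pts (pt v) (pt w) \<longleftrightarrow> \<langle>v, w\<rangle> = 0"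
proof -
  obtain k l where "k \<noteq> 0" "rep (pt v) = v \<cdot> k" "l \<noteq> 0" "rep (pt w) = w \<cdot> l"
    using rep_pt assms by metis
  moreover from this have "hconj k \<noteq> 0" by (metis norm_eq_zero norm_hconj)
  ultimately show ?thesis
    by (simp add: orthogonal_pts_def form_smul_left form_smul_right)
qed

text \<open>
  From here on points are handled through arbitrary representatives \<open>v\<close> instead of the
  chosen ones; this works because the factors coming from a change of the representative combine to
  \<open>k * hconj k\<close>, which is real and cancels.
\<close>
lemma pi'_pt:
  assumes "quad v \<noteq> 0"
  shows "pi' (pt v) u = inverse (quad v) *\<^sub>R (v \<cdot> \<langle>v, u\<rangle>)"
proof -
  obtain k where k: "k \<noteq> 0" "rep (pt v) = v \<cdot> k"
    using rep_pt assms quad_nonzero_imp by blast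
  have "pi' (pt v) u = v \<cdot> (k * ((hconj k * \<langle>v, u\<rangle>) / ((norm k)\<^sup>2 * quad v) *\<^sub>R 1))"
    unfolding pi'_def k(2) form_self quad_smul form_smul_left by (simp add: smul_mult divide_inverse)
  also have "\<dots> = v \<cdot> (inverse ((norm k)\<^sup>2 * quad v) *\<^sub>R (k * hconj k * \<langle>v, u\<rangle>))"
    by (simp add: divide_inverse inverse_scaleR_distrib mult.assoc)
  also have "\<dots> = inverse (quad v) *\<^sub>R (v \<cdot> \<langle>v, u\<rangle>)"
    using k by (simp add: mult_hconj_self smul_scaleR_right)
  finally show ?thesis .
qed

lemma pi_pt:
  assumes "quad v \<noteq> 0"
  shows "pi (pt v) u = u - inverse (quad v) *\<^sub>R (v \<cdot> \<langle>v, u\<rangle>)"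
  using pi'_pt[OF assms] by (simp add: pi_def)

lemma form_pi: "quad v \<noteq> 0 \<Longrightarrow> \<langle>v, pi (pt v) u\<rangle> = 0"
  by (simp add: pi_pt form.diff_right form_scaleR_right form_smul_right form_self)

lemma re_form_orthogonal_pi:
  assumes "quad v \<noteq> 0" "\<langle>v, w\<rangle> = 0"
  shows "re_form w (pi (pt v) u) = re_form w u"
  using assms form_eq_0_commute[of v w]
  by (simp add: pi_pt re_form_def form.diff_right form_scaleR_right form_smul_right)

lemma pi_orthogonal: "quad v \<noteq> 0 \<Longrightarrow> \<langle>v, w\<rangle> = 0 \<Longrightarrow> pi (pt v) w = w"
  by (simp add: pi_pt smul.zero_right)

lemma pi_smul_self: "quad v \<noteq> 0 \<Longrightarrow> pi (pt v) (v \<cdot> k) = 0"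
  by (simp add: pi_pt form_smul_right form_self smul_scaleR_right)

lemma pi_add: "quad v \<noteq> 0 \<Longrightarrow> pi (pt v) (u + w) = pi (pt v) u + pi (pt v) w"
  by (simp add: pi_pt form_add_right smul_add_right scaleR_add_right)

lemma pi_diff: "quad v \<noteq> 0 \<Longrightarrow> pi (pt v) (u - w) = pi (pt v) u - pi (pt v) w"
  by (simp add: pi_pt form.diff_right smul.diff_right scaleR_diff_right)

lemma pi_smul: "quad v \<noteq> 0 \<Longrightarrow> pi (pt v) (u \<cdot> k) = pi (pt v) u \<cdot> k"
  by (simp add: pi_pt form_smul_right smul.diff_left smul_mult smul_scaleR_left)

lemma pi_scaleR: "quad v \<noteq> 0 \<Longrightarrow> pi (pt v) (r *\<^sub>R u) = r *\<^sub>R pi (pt v) u"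
  using pi_smul[of v u "of_real r"] by (simp add: smul_of_real)

lemma linear_pi: "quad v \<noteq> 0 \<Longrightarrow> linear (pi (pt v))"
  by (intro linearI pi_add pi_scaleR)

lemma Lin_add: "t \<in> Lin \<Longrightarrow> t (u + v) = t u + t v"
  and Lin_smul: "t \<in> Lin \<Longrightarrow> t (v \<cdot> k) = t v \<cdot> k"
  by (simp_all add: Lin_def)

lemma Lin_scaleR: "t \<in> Lin \<Longrightarrow> t (r *\<^sub>R v) = r *\<^sub>R t v"
  using Lin_smul[of t v "of_real r"] by (simp add: smul_of_real)

lemma Lin_imp_bounded_linear: "t \<in> Lin \<Longrightarrow> bounded_linear t"
  by (simp add: linear_conv_bounded_linear[symmetric] linearI Lin_add Lin_scaleR)

lemma tangent_pt_iff:
  assumes "quad v \<noteq> 0"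
  shows "t \<in> tangent (pt v) \<longleftrightarrow>
    t \<in> Lin \<and> (\<forall>u. \<langle>v, u\<rangle> = 0 \<longrightarrow> t u = 0) \<and> (\<forall>u. \<langle>v, t u\<rangle> = 0)"
proof -
  obtain k where "k \<noteq> 0" "rep (pt v) = v \<cdot> k"
    using rep_pt assms quad_nonzero_imp by blast
  moreover from this have "hconj k \<noteq> 0" by (metis norm_eq_zero norm_hconj)
  ultimately show ?thesis
    by (simp add: tangent_def form_smul_left)
qed

lemma tangent_imp_Lin: "t \<in> tangent x \<Longrightarrow> t \<in> Lin"
  by (simp add: tangent_def)

lemma tangent_orthogonal: "quad v \<noteq> 0 \<Longrightarrow> t \<in> tangent (pt v) \<Longrightarrow> \<langle>v, t u\<rangle> = 0"
  by (simp add: tangent_pt_iff)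

lemma tangent_kernel: "quad v \<noteq> 0 \<Longrightarrow> t \<in> tangent (pt v) \<Longrightarrow> \<langle>v, u\<rangle> = 0 \<Longrightarrow> t u = 0"
  by (simp add: tangent_pt_iff)

section \<open>Tangent vectors and the metric\<close>

text \<open>
  A tangent vector at \<open>pt v\<close> is determined by its value at \<open>v\<close>, because it vanishes on
  the orthogonal complement. All later comparisons of tangent vectors reduce to this value.
\<close>
lemma tangent_apply:
  assumes "quad v \<noteq> 0" "t \<in> tangent (pt v)"
  shows "t u = inverse (quad v) *\<^sub>R (t v \<cdot> \<langle>v, u\<rangle>)"
proof -
  have L: "t \<in> Lin" using assms(2) by (rule tangent_imp_Lin)
  have "u = pi (pt v) u + inverse (quad v) *\<^sub>R (v \<cdot> \<langle>v, u\<rangle>)"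
    using assms(1) by (simp add: pi_pt)
  then have "t u = t (pi (pt v) u) + inverse (quad v) *\<^sub>R (t v \<cdot> \<langle>v, u\<rangle>)"
    using Lin_add[OF L] Lin_smul[OF L] Lin_scaleR[OF L] by metis
  then show ?thesis
    using tangent_kernel[OF assms form_pi[OF assms(1)]] by simp
qed

lemma tangent_ext:
  assumes "quad v \<noteq> 0" "s \<in> tangent (pt v)" "t \<in> tangent (pt v)" "s v = t v"
  shows "s = t"
proof
  fix u
  show "s u = t u"
    unfolding tangent_apply[OF assms(1,2), of u] tangent_apply[OF assms(1,3), of u] assms(4) ..
qed

text \<open>
  The linear map that sends \<open>v\<close> to \<open>w\<close> and vanishes on the orthogonal complement of
  \<open>v\<close>.
\<close>
definition rank_one :: "'v \<Rightarrow> 'v \<Rightarrow> 'v \<Rightarrow> 'v"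
  where "rank_one v w u = inverse (quad v) *\<^sub>R (w \<cdot> \<langle>v, u\<rangle>)"

lemma rank_one_Lin: "rank_one v w \<in> Lin"
  by (simp add: Lin_def rank_one_def form_add_right smul_add_right scaleR_add_right
      form_smul_right smul_mult smul_scaleR_left)

lemma rank_one_tangent: "quad v \<noteq> 0 \<Longrightarrow> \<langle>v, w\<rangle> = 0 \<Longrightarrow> rank_one v w \<in> tangent (pt v)"
  using rank_one_Lin
  by (simp add: tangent_pt_iff rank_one_def smul.zero_right form_scaleR_right form_smul_right)

lemma rank_one_self: "quad v \<noteq> 0 \<Longrightarrow> rank_one v w v = w"
  by (simp add: rank_one_def form_self smul_scaleR_right)

lemma tangent_sum:
  assumes "finite J" "quad v \<noteq> 0" "\<And>j. j \<in> J \<Longrightarrow> t j \<in> tangent (pt v)"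
  shows "(\<lambda>u. \<Sum>j\<in>J. (c j :: real) *\<^sub>R t j u) \<in> tangent (pt v)"
proof -
  have L: "t j \<in> Lin" if "j \<in> J" for j using assms(3)[OF that] by (rule tangent_imp_Lin)
  have "(\<lambda>u. \<Sum>j\<in>J. c j *\<^sub>R t j u) \<in> Lin"
    using L unfolding Lin_def mem_Collect_eq
    by (simp add: Lin_add Lin_smul scaleR_add_right sum.distrib smul.sum_left smul_scaleR_left)
  then show ?thesis
    using assms by (simp add: tangent_pt_iff form.sum_right form_scaleR_right)
qed

lemma tangent_add:
  assumes "quad v \<noteq> 0" "s \<in> tangent (pt v)" "t \<in> tangent (pt v)"
  shows "(\<lambda>u. s u + t u) \<in> tangent (pt v)"
  using assms by (simp add: tangent_pt_iff Lin_def form_add_right smul_add_left)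

lemma tangent_scaleR:
  assumes "quad v \<noteq> 0" "t \<in> tangent (pt v)"
  shows "(\<lambda>u. (r::real) *\<^sub>R t u) \<in> tangent (pt v)"
  using assms by (simp add: tangent_pt_iff Lin_def form_scaleR_right smul_scaleR_left scaleR_add_right)

lemma tang_pt:
  assumes "quad v \<noteq> 0" "t \<in> Lin"
  shows "tang t (pt v) = rank_one v (pi (pt v) (t v))"
  using assms by (auto simp: tang_def rank_one_def pi'_pt Lin_scaleR Lin_smul pi_scaleR pi_smul)

lemma tang_tangent: "quad v \<noteq> 0 \<Longrightarrow> t \<in> Lin \<Longrightarrow> tang t (pt v) \<in> tangent (pt v)"
  by (simp add: tang_pt rank_one_tangent form_pi)

lemma tang_self: "quad v \<noteq> 0 \<Longrightarrow> t \<in> Lin \<Longrightarrow> tang t (pt v) v = pi (pt v) (t v)"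
  by (simp add: tang_pt rank_one_self)

lemma tang_of_tangent: "quad v \<noteq> 0 \<Longrightarrow> t \<in> tangent (pt v) \<Longrightarrow> tang t (pt v) = t"
  by (rule tangent_ext) (auto simp: tang_tangent tangent_imp_Lin tang_self pi_orthogonal tangent_orthogonal)

lemma adjoint_tangent:
  assumes "quad v \<noteq> 0" "t \<in> tangent (pt v)"
  shows "adjoint_map t = (\<lambda>u. inverse (quad v) *\<^sub>R (v \<cdot> \<langle>t v, u\<rangle>))"
  unfolding adjoint_map_def
proof (rule the_equality)
  show adj: "\<forall>u w. \<langle>inverse (quad v) *\<^sub>R (v \<cdot> \<langle>t v, u\<rangle>), w\<rangle> = \<langle>u, t w\<rangle>"
  proof (intro allI)
    fix u w
    have "\<langle>u, t w\<rangle> = inverse (quad v) *\<^sub>R (\<langle>u, t v\<rangle> * \<langle>v, w\<rangle>)"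
      by (subst tangent_apply[OF assms]) (simp add: form_scaleR_right form_smul_right)
    moreover have "hconj \<langle>t v, u\<rangle> = \<langle>u, t v\<rangle>" by (rule form_hermitian[symmetric])
    ultimately show "\<langle>inverse (quad v) *\<^sub>R (v \<cdot> \<langle>t v, u\<rangle>), w\<rangle> = \<langle>u, t w\<rangle>"
      by (simp add: form_scaleR_left form_smul_left)
  qed
  fix s assume s: "\<forall>u w. \<langle>s u, w\<rangle> = \<langle>u, t w\<rangle>"
  show "s = (\<lambda>u. inverse (quad v) *\<^sub>R (v \<cdot> \<langle>t v, u\<rangle>))"
  proof
    fix u
    have "s u - inverse (quad v) *\<^sub>R (v \<cdot> \<langle>t v, u\<rangle>) = 0"
      by (rule re_form_nondegenerate) (simp add: re_form_def form.diff_left s adj)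
    then show "s u = inverse (quad v) *\<^sub>R (v \<cdot> \<langle>t v, u\<rangle>)" by simp
  qed
qed

text \<open>
  The endomorphism \<open>s\<^sup>* t\<close> factors through the scalars as
  \<open>w \<mapsto> g w \<mapsto> v \<cdot> g w\<close>. Cyclicity of the trace reduces its trace to that of a left
  multiplication on the scalars.
\<close>
lemma metric_tangent:
  assumes "quad v \<noteq> 0" "s \<in> tangent (pt v)" "t \<in> tangent (pt v)"
  shows "metric \<sigma> s t = \<sigma> * (re_form (s v) (t v) / quad v)"
proof -
  define c where "c = (inverse (quad v))\<^sup>2 *\<^sub>R \<langle>s v, t v\<rangle>"
  define g where "g w = c * \<langle>v, w\<rangle>" for w
  have "(adjoint_map s \<circ> t) w = v \<cdot> g w" for w
  proof -
    have "\<langle>s v, t w\<rangle> = inverse (quad v) *\<^sub>R (\<langle>s v, t v\<rangle> * \<langle>v, w\<rangle>)"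
      by (subst tangent_apply[OF assms(1,3)]) (simp add: form_scaleR_right form_smul_right)
    then show ?thesis
      by (simp add: adjoint_tangent[OF assms(1,2)] g_def c_def power2_eq_square smul_scaleR_right)
  qed
  then have *: "adjoint_map s \<circ> t = (\<lambda>k. v \<cdot> k) \<circ> g" by auto
  have "linear (\<lambda>k. v \<cdot> k)" by (simp add: linearI smul_add_right smul_scaleR_right)
  moreover have "linear g"
    by (simp add: linearI g_def form_add_right form_scaleR_right algebra_simps)
  ultimately have "real_trace (adjoint_map s \<circ> t) = real_trace (g \<circ> (\<lambda>k. v \<cdot> k))"
    unfolding * by (rule real_trace_compose)
  also have "g \<circ> (\<lambda>k. v \<cdot> k) = (\<lambda>k. (inverse (quad v) *\<^sub>R \<langle>s v, t v\<rangle>) * k)"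
    using assms(1) by (intro ext) (simp add: g_def c_def form_smul_right form_self power2_eq_square)
  also have "real_trace \<dots> = real DIM('k) * (re_form (s v) (t v) / quad v)"
    by (simp only: trace_left_mult) (simp add: re_form_def divide_inverse)
  finally show ?thesis unfolding metric_def by (simp only:) simp
qed

section \<open>The Levi-Civita connection\<close>
lemma has_derivative_transform_nonisotropic:
  assumes "(f has_derivative D) (at v)" "quad v \<noteq> 0" "\<And>z. quad z \<noteq> 0 \<Longrightarrow> f z = g z"
  shows "(g has_derivative D) (at v)"
  by (rule has_derivative_transform_within_open[OF assms(1) open_nonisotropic_vectors]) (use assms in \<open>auto simp: nonisotropic_vectors_iff\<close>)

lemma has_derivative_pt_smul:
  assumes "((\<lambda>z. F (pt z)) has_derivative D) (at v)" "k \<noteq> 0"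
  shows "((\<lambda>z. F (pt z)) has_derivative (\<lambda>h. D (h \<cdot> inverse k))) (at (v \<cdot> k))"
proof -
  have "((\<lambda>z. z \<cdot> inverse k) has_derivative (\<lambda>h. h \<cdot> inverse k)) (at (v \<cdot> k))"
    by (rule bounded_linear_imp_has_derivative) (rule smul.bounded_linear_left)
  moreover have "v \<cdot> k \<cdot> inverse k = v"
    using assms(2) by (simp add: smul_mult[symmetric])
  ultimately have "((\<lambda>z. F (pt (z \<cdot> inverse k))) has_derivative (\<lambda>h. D (h \<cdot> inverse k))) (at (v \<cdot> k))"
    using has_derivative_compose[of "\<lambda>z. z \<cdot> inverse k" _ "v \<cdot> k" UNIV "\<lambda>z. F (pt z)" D] assms(1) by simp
  then show ?thesis using assms(2) by (simp add: pt_smul)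
qed

text \<open>
  A function of points is constant along \<open>v + e (v \<cdot> k) = v \<cdot> (1 + e k)\<close> for small
  \<open>e\<close>.
\<close>
lemma has_derivative_pt_radial:
  assumes "((\<lambda>z. F (pt z)) has_derivative D) (at v)"
  shows "D (v \<cdot> k) = 0"
proof -
  \<comment> \<open>On this neighbourhood of \<open>0\<close> the path stays on the point \<open>pt v\<close>.\<close>
  define S where "S = {e::real. 1 + e *\<^sub>R k \<noteq> 0}"
  have "S = (\<lambda>e. 1 + e *\<^sub>R k) -` (- {0})" by (auto simp: S_def)
  then have S: "open S" by (simp only:) (intro open_vimage continuous_intros; auto)
  have path: "v + e *\<^sub>R (v \<cdot> k) = v \<cdot> (1 + e *\<^sub>R k)" for e
    by (simp add: smul_add_right smul_scaleR_right)
  have "((\<lambda>e::real. v + e *\<^sub>R (v \<cdot> k)) has_derivative (\<lambda>e. e *\<^sub>R (v \<cdot> k))) (at 0)"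
    by (auto intro!: derivative_eq_intros)
  then have "((\<lambda>e. F (pt (v + e *\<^sub>R (v \<cdot> k)))) has_derivative (\<lambda>e. D (e *\<^sub>R (v \<cdot> k)))) (at 0)"
    using has_derivative_compose[of "\<lambda>e. v + e *\<^sub>R (v \<cdot> k)" _ "0::real" UNIV "\<lambda>z. F (pt z)" D] assms
    by simp
  then have "((\<lambda>e. F (pt v)) has_derivative (\<lambda>e. D (e *\<^sub>R (v \<cdot> k)))) (at 0)"
    by (rule has_derivative_transform_within_open[OF _ S])
      (auto simp: S_def path pt_smul)
  from has_derivative_unique[OF this has_derivative_const]
  have "D (1 *\<^sub>R (v \<cdot> k)) = 0" by meson
  then show ?thesis by simp
qed

lemma deriv_along_pt:
  assumes "((\<lambda>z. f (pt z)) has_derivative D) (at v)" "v \<noteq> 0" "t \<in> Lin"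
  shows "deriv_along (pt v) t f = D (t v)"
proof -
  obtain k where k: "k \<noteq> 0" "rep (pt v) = v \<cdot> k" using rep_pt assms(2) by blast
  have "frechet_derivative (\<lambda>z. f (pt z)) (at (v \<cdot> k)) = (\<lambda>h. D (h \<cdot> inverse k))"
    using frechet_derivative_at[OF has_derivative_pt_smul[OF assms(1) k(1)]] by simp
  then show ?thesis
    using k by (simp add: deriv_along_def Lin_smul[OF assms(3)] smul_mult[symmetric])
qed

lemma has_derivative_quad: "(quad has_derivative (\<lambda>h. 2 * re_form v h)) (at v)"
proof -
  have "((\<lambda>v. re_form v v) has_derivative (\<lambda>h. re_form v h + re_form h v)) (at v)"
    by (rule re_form.FDERIV) (rule has_derivative_ident)+
  then show ?thesis
    by (simp add: quad_def[abs_def] re_form_commute[of _ v])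
qed

lemma smooth_on_nonisotropic_linear: "bounded_linear L \<Longrightarrow> smooth_on nonisotropic_vectors L"
  by (rule smooth_on_bounded_linear[OF open_nonisotropic_vectors])

lemma smooth_on_nonisotropic_inverse_quad: "smooth_on nonisotropic_vectors (\<lambda>v. inverse (quad v))"
proof (rule smooth_on_inverse[OF open_nonisotropic_vectors])
  show "smooth_on nonisotropic_vectors quad"
    unfolding quad_def by (intro re_form.smooth_on open_nonisotropic_vectors smooth_on_nonisotropic_linear bounded_linear_ident)
qed (simp add: nonisotropic_vectors_iff)

lemma smooth_on_nonisotropic_projection:
  assumes "smooth_on nonisotropic_vectors g"
  shows "smooth_on nonisotropic_vectors (\<lambda>v. inverse (quad v) *\<^sub>R (v \<cdot> \<langle>v, g v\<rangle>))"
  by (intro bounded_bilinear.smooth_on[OF bounded_bilinear_scaleR] smul.smooth_on form.smooth_on assms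
      open_nonisotropic_vectors smooth_on_nonisotropic_inverse_quad smooth_on_nonisotropic_linear bounded_linear_ident)

text \<open>
  Every linear endomorphism of \<open>V\<close> induces a vector field. This provides enough vector fields
  to extend a given tangent vector and to expand fields along curves.
\<close>
lemma vector_field_tang:
  assumes "t \<in> Lin"
  shows "vector_field (tang t)"
  unfolding vector_field_def
proof (intro conjI ballI allI)
  fix x assume "x \<in> nonisotropic"
  then show "tang t x \<in> tangent x"
    by (elim nonisotropicE) (simp add: tang_tangent assms)
next
  fix u
  have t: "smooth_on nonisotropic_vectors t"
    by (intro smooth_on_nonisotropic_linear Lin_imp_bounded_linear assms)
  have "smooth_on nonisotropic_vectors
    (\<lambda>v. inverse (quad v) *\<^sub>R ((t v + (-1) *\<^sub>R (inverse (quad v) *\<^sub>R (v \<cdot> \<langle>v, t v\<rangle>))) \<cdot> \<langle>v, u\<rangle>))"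
    by (intro bounded_bilinear.smooth_on[OF bounded_bilinear_scaleR] smul.smooth_on form.smooth_on
      open_nonisotropic_vectors smooth_on_nonisotropic_inverse_quad smooth_on_nonisotropic_linear bounded_linear_ident smooth_on_const
      smooth_on_add smooth_on_nonisotropic_projection t)
  then show "smooth_on nonisotropic_vectors (\<lambda>v. tang t (pt v) u)"
    by (rule smooth_on_cong[rotated]) (simp add: nonisotropic_vectors_iff tang_pt assms rank_one_def pi_pt)
qed

text \<open>
  The derivative of the endomorphism-valued lift of \<open>Y\<close> at the vector \<open>v\<close> in the
  direction \<open>h\<close>, applied to the fixed vector \<open>u\<close>.
\<close>
definition flat_derivative :: "('v set \<Rightarrow> 'v \<Rightarrow> 'v) \<Rightarrow> 'v \<Rightarrow> 'v \<Rightarrow> 'v \<Rightarrow> 'v"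
  where "flat_derivative Y v h u = frechet_derivative (\<lambda>z. Y (pt z) u) (at v) h"

lemma vector_field_has_derivative:
  assumes "vector_field Y" "quad v \<noteq> 0"
  shows "((\<lambda>z. Y (pt z) u) has_derivative (\<lambda>h. flat_derivative Y v h u)) (at v)"
proof -
  have "smooth_on nonisotropic_vectors (\<lambda>z. Y (pt z) u)"
    using assms(1) by (simp add: vector_field_def)
  then have "(\<lambda>z. Y (pt z) u) differentiable (at v)"
    using smooth_on_imp_differentiable[OF open_nonisotropic_vectors] assms(2) by (simp add: nonisotropic_vectors_iff)
  then show ?thesis
    unfolding flat_derivative_def by (simp add: frechet_derivative_works eta_contract_eq)
qed

lemma vector_field_tangent: "vector_field Y \<Longrightarrow> quad v \<noteq> 0 \<Longrightarrow> Y (pt v) \<in> tangent (pt v)"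
  by (simp add: vector_field_def pt_in_nonisotropic)

text \<open>
  Product rule for the map \<open>z \<mapsto> Y (pt z) z\<close>, in which the vector enters twice; expanding
  the argument in a real basis separates the two dependences.
\<close>
lemma vector_field_at_vector_has_derivative:
  assumes "vector_field Y" "quad v \<noteq> 0"
  shows "((\<lambda>z. Y (pt z) z) has_derivative (\<lambda>h. flat_derivative Y v h v + Y (pt v) h)) (at v)"
proof -
  have expand: "Y (pt z) u = (\<Sum>b\<in>Basis. inner u b *\<^sub>R Y (pt z) b)" if "quad z \<noteq> 0" for z u
  proof -
    have "bounded_linear (Y (pt z))"
      using vector_field_tangent[OF assms(1) that] by (intro Lin_imp_bounded_linear tangent_imp_Lin)
    then have "linear (Y (pt z))" by (rule bounded_linear.linear)
    then have "Y (pt z) (\<Sum>b\<in>Basis. inner u b *\<^sub>R b) = (\<Sum>b\<in>Basis. inner u b *\<^sub>R Y (pt z) b)"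
      by (simp add: linear_sum linear_scale)
    then show ?thesis by (simp add: euclidean_representation)
  qed
  have "((\<lambda>z. \<Sum>b\<in>Basis. inner v b *\<^sub>R Y (pt z) b) has_derivative
      (\<lambda>h. \<Sum>b\<in>Basis. inner v b *\<^sub>R flat_derivative Y v h b)) (at v)"
    by (auto intro!: derivative_eq_intros vector_field_has_derivative assms)
  then have "((\<lambda>z. Y (pt z) v) has_derivative
      (\<lambda>h. \<Sum>b\<in>Basis. inner v b *\<^sub>R flat_derivative Y v h b)) (at v)"
    by (rule has_derivative_transform_nonisotropic[OF _ assms(2)]) (rule expand[symmetric])
  from has_derivative_unique[OF vector_field_has_derivative[OF assms, of v] this]
  have *: "flat_derivative Y v h v = (\<Sum>b\<in>Basis. inner v b *\<^sub>R flat_derivative Y v h b)" for h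
    by (rule fun_cong)
  have "((\<lambda>z. \<Sum>b\<in>Basis. inner z b *\<^sub>R Y (pt z) b) has_derivative
      (\<lambda>h. \<Sum>b\<in>Basis. inner v b *\<^sub>R flat_derivative Y v h b + inner h b *\<^sub>R Y (pt v) b)) (at v)"
    by (auto intro!: derivative_eq_intros vector_field_has_derivative assms)
  then have "((\<lambda>z. Y (pt z) z) has_derivative
      (\<lambda>h. \<Sum>b\<in>Basis. inner v b *\<^sub>R flat_derivative Y v h b + inner h b *\<^sub>R Y (pt v) b)) (at v)"
    by (rule has_derivative_transform_nonisotropic[OF _ assms(2)]) (rule expand[symmetric])
  also have "(\<lambda>h. \<Sum>b\<in>Basis. inner v b *\<^sub>R flat_derivative Y v h b + inner h b *\<^sub>R Y (pt v) b)
    = (\<lambda>h. flat_derivative Y v h v + Y (pt v) h)"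
    by (intro ext) (simp add: sum.distrib flip: * expand[OF assms(2)])
  finally show ?thesis .
qed

text \<open>
  The value at \<open>v\<close> of the candidate for the covariant derivative of \<open>Y\<close> along
  \<open>X\<close>.
\<close>
definition flat_connection :: "('v set \<Rightarrow> 'v \<Rightarrow> 'v) \<Rightarrow> ('v set \<Rightarrow> 'v \<Rightarrow> 'v) \<Rightarrow> 'v \<Rightarrow> 'v"
  where "flat_connection X Y v = pi (pt v) (flat_derivative Y v (X (pt v) v) v)"

lemma levi_civita_vector_field:
  "levi_civita \<sigma> nabla \<Longrightarrow> vector_field X \<Longrightarrow> vector_field Y \<Longrightarrow> vector_field (nabla X Y)"
  by (simp add: levi_civita_def)

lemma levi_civita_torsion_free:
  "levi_civita \<sigma> nabla \<Longrightarrow> vector_field X \<Longrightarrow> vector_field Y \<Longrightarrow> smooth_fun f \<Longrightarrow> quad v \<noteq> 0 \<Longrightarrow>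
    deriv_along (pt v) (\<lambda>u. nabla X Y (pt v) u - nabla Y X (pt v) u) f =
      deriv_along (pt v) (X (pt v)) (\<lambda>z. deriv_along z (Y z) f)
      - deriv_along (pt v) (Y (pt v)) (\<lambda>z. deriv_along z (X z) f)"
  unfolding levi_civita_def using pt_in_nonisotropic[of v] by blast

lemma levi_civita_metric:
  "levi_civita \<sigma> nabla \<Longrightarrow> vector_field X \<Longrightarrow> vector_field Y \<Longrightarrow> vector_field Z \<Longrightarrow> quad v \<noteq> 0 \<Longrightarrow>
    deriv_along (pt v) (X (pt v)) (\<lambda>z. metric \<sigma> (Y z) (Z z)) =
      metric \<sigma> (nabla X Y (pt v)) (Z (pt v)) + metric \<sigma> (Y (pt v)) (nabla X Z (pt v))"
  unfolding levi_civita_def using pt_in_nonisotropic[of v] by blast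

lemma projection_has_derivative:
  assumes "quad z \<noteq> 0"
  shows "((\<lambda>z. inverse (quad z) *\<^sub>R (z \<cdot> \<langle>z, v\<rangle>)) has_derivative
    (\<lambda>h. inverse (quad z) *\<^sub>R (z \<cdot> \<langle>h, v\<rangle> + h \<cdot> \<langle>z, v\<rangle>)
      + (- (inverse (quad z) * (2 * re_form z h) * inverse (quad z))) *\<^sub>R (z \<cdot> \<langle>z, v\<rangle>))) (at z)"
proof -
  have "((\<lambda>z. \<langle>z, v\<rangle>) has_derivative (\<lambda>h. \<langle>h, v\<rangle>)) (at z)"
    by (rule bounded_linear_imp_has_derivative) (rule form.bounded_linear_left)
  then have "((\<lambda>z. z \<cdot> \<langle>z, v\<rangle>) has_derivative (\<lambda>h. z \<cdot> \<langle>h, v\<rangle> + h \<cdot> \<langle>z, v\<rangle>)) (at z)"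
    by (rule smul.FDERIV[OF has_derivative_ident])
  then show ?thesis
    by (rule has_derivative_scaleR[OF Deriv.has_derivative_inverse[OF assms has_derivative_quad]])
qed

text \<open>
  A tangent vector \<open>s\<close> at \<open>pt z\<close> changes the projection onto the point by
  \<open>s + s\<^sup>*\<close>; the derivative of \<open>quad\<close> drops out because \<open>s z\<close> is orthogonal to
  \<open>z\<close>.
\<close>
lemma deriv_along_projection:
  assumes "vector_field Y" "quad z \<noteq> 0"
  shows "deriv_along (pt z) (Y (pt z)) (\<lambda>x. inner (pi' x v) e) =
    inner (inverse (quad z) *\<^sub>R (z \<cdot> \<langle>Y (pt z) z, v\<rangle> + Y (pt z) z \<cdot> \<langle>z, v\<rangle>)) e"
proof -
  note Y = vector_field_tangent[OF assms]
  have "re_form z (Y (pt z) z) = 0"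
    using tangent_orthogonal[OF assms(2) Y] by (simp add: re_form_def)
  moreover have "((\<lambda>z. inner (pi' (pt z) v) e) has_derivative
    (\<lambda>h. inner (inverse (quad z) *\<^sub>R (z \<cdot> \<langle>h, v\<rangle> + h \<cdot> \<langle>z, v\<rangle>)
      + (- (inverse (quad z) * (2 * re_form z h) * inverse (quad z))) *\<^sub>R (z \<cdot> \<langle>z, v\<rangle>)) e)) (at z)"
    by (rule has_derivative_transform_nonisotropic[OF has_derivative_inner_left[OF projection_has_derivative] assms(2)])
      (simp_all add: assms(2) pi'_pt)
  ultimately show ?thesis
    using deriv_along_pt[OF _ quad_nonzero_imp[OF assms(2)] tangent_imp_Lin[OF Y]] by simp
qed

text \<open>
  The second derivative is only needed at the point whose representative \<open>v\<close> is also the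
  argument of the projection. There most terms of the product rule vanish, since \<open>X v\<close> and
  \<open>Y v\<close> are orthogonal to \<open>v\<close>.
\<close>
lemma deriv_along_deriv_along_projection:
  assumes "vector_field X" "vector_field Y" "quad v \<noteq> 0"
  defines "d \<equiv> flat_derivative Y v (X (pt v) v) v"
  shows "deriv_along (pt v) (X (pt v)) (\<lambda>x. deriv_along x (Y x) (\<lambda>x. inner (pi' x v) e)) =
    inner (d + inverse (quad v) *\<^sub>R (v \<cdot> \<langle>d, v\<rangle>)) e"
proof -
  note XT = vector_field_tangent[OF assms(1,3)] and YT = vector_field_tangent[OF assms(2,3)]
  define Y' where "Y' h = flat_derivative Y v h v + Y (pt v) h" for h
  define Xv where "Xv = X (pt v) v"
  have X0: "\<langle>v, Xv\<rangle> = 0" "\<langle>Xv, v\<rangle> = 0" "re_form v Xv = 0"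
    using tangent_orthogonal[OF assms(3) XT, of v] form_eq_0_commute[of Xv v] by (simp_all add: Xv_def re_form_def)
  have Y0: "\<langle>Y (pt v) v, v\<rangle> = 0"
    using tangent_orthogonal[OF assms(3) YT, of v] form_eq_0_commute[of "Y (pt v) v" v] by simp
  have Y'X: "Y' Xv = d"
    using tangent_kernel[OF assms(3) YT X0(1)] by (simp add: Y'_def d_def Xv_def)
  have Y': "((\<lambda>z. Y (pt z) z) has_derivative Y') (at v)"
    unfolding Y'_def by (rule vector_field_at_vector_has_derivative[OF assms(2,3)])
  have fv: "((\<lambda>z. \<langle>z, v\<rangle>) has_derivative (\<lambda>h. \<langle>h, v\<rangle>)) (at v)"
    by (rule bounded_linear_imp_has_derivative) (rule form.bounded_linear_left)
  have Yv: "((\<lambda>z. \<langle>Y (pt z) z, v\<rangle>) has_derivative (\<lambda>h. \<langle>Y' h, v\<rangle>)) (at v)"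
    using has_derivative_compose[OF Y' bounded_linear_imp_has_derivative[OF form.bounded_linear_left]] .
  define D where "D h = inverse (quad v) *\<^sub>R ((v \<cdot> \<langle>Y' h, v\<rangle> + h \<cdot> \<langle>Y (pt v) v, v\<rangle>)
      + (Y (pt v) v \<cdot> \<langle>h, v\<rangle> + Y' h \<cdot> \<langle>v, v\<rangle>))
      + (- (inverse (quad v) * (2 * re_form v h) * inverse (quad v))) *\<^sub>R (v \<cdot> \<langle>Y (pt v) v, v\<rangle> + Y (pt v) v \<cdot> \<langle>v, v\<rangle>)" for h
  have "((\<lambda>z. inverse (quad z) *\<^sub>R (z \<cdot> \<langle>Y (pt z) z, v\<rangle> + Y (pt z) z \<cdot> \<langle>z, v\<rangle>)) has_derivative D) (at v)"
    unfolding D_def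
    by (intro has_derivative_scaleR Deriv.has_derivative_inverse assms(3) has_derivative_quad has_derivative_add
        smul.FDERIV has_derivative_ident Y' Yv fv)
  from has_derivative_inner_left[OF this, of e]
  have "((\<lambda>z. deriv_along (pt z) (Y (pt z)) (\<lambda>x. inner (pi' x v) e)) has_derivative (\<lambda>h. inner (D h) e)) (at v)"
    by (rule has_derivative_transform_nonisotropic[OF _ assms(3)]) (simp add: deriv_along_projection assms(2))
  from deriv_along_pt[OF this quad_nonzero_imp[OF assms(3)] tangent_imp_Lin[OF XT]]
  have "deriv_along (pt v) (X (pt v)) (\<lambda>x. deriv_along x (Y x) (\<lambda>x. inner (pi' x v) e)) = inner (D Xv) e"
    by (simp add: Xv_def)
  moreover have "D Xv = d + inverse (quad v) *\<^sub>R (v \<cdot> \<langle>d, v\<rangle>)"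
    using assms(3) by (simp add: D_def Y'X X0 Y0 smul.zero_right form_self smul_scaleR_right scaleR_add_right)
  ultimately show ?thesis by simp
qed

text \<open>
  By the two preceding lemmas, vanishing torsion of \<open>nabla\<close>, tested on all components of the
  projection, determines the commutator up to a multiple of \<open>v\<close>, which \<open>pi\<close> removes.
\<close>
lemma torsion_free_flat_connection:
  assumes "levi_civita \<sigma> nabla" "vector_field X" "vector_field Y" "quad v \<noteq> 0"
  shows "nabla X Y (pt v) v - nabla Y X (pt v) v = flat_connection X Y v - flat_connection Y X v"
proof -
  define T where "T u = nabla X Y (pt v) u - nabla Y X (pt v) u" for u
  define d where "d = flat_derivative Y v (X (pt v) v) v"
  define d' where "d' = flat_derivative X v (Y (pt v) v) v"
  note nXY = vector_field_tangent[OF levi_civita_vector_field[OF assms(1,2,3)] assms(4)]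
  note nYX = vector_field_tangent[OF levi_civita_vector_field[OF assms(1,3,2)] assms(4)]
  have T: "T \<in> tangent (pt v)"
    using tangent_add[OF assms(4) nXY tangent_scaleR[OF assms(4) nYX, of "-1"]]
    by (simp add: T_def[abs_def])
  have T0: "re_form v (T v) = 0" "\<langle>T v, v\<rangle> = 0"
    using tangent_orthogonal[OF assms(4) T, of v] form_eq_0_commute[of "T v" v] by (simp_all add: re_form_def)
  have "inner (T v) e = inner ((d + inverse (quad v) *\<^sub>R (v \<cdot> \<langle>d, v\<rangle>)) - (d' + inverse (quad v) *\<^sub>R (v \<cdot> \<langle>d', v\<rangle>))) e"
    for e
  proof -
    let ?f = "\<lambda>x. inner (pi' x v) e"
    have "smooth_on nonisotropic_vectors (\<lambda>z. inner (inverse (quad z) *\<^sub>R (z \<cdot> \<langle>z, v\<rangle>)) e)"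
      by (intro bounded_bilinear.smooth_on[OF bounded_bilinear_inner] smooth_on_nonisotropic_projection
          open_nonisotropic_vectors smooth_on_const)
    then have "smooth_fun ?f"
      unfolding smooth_fun_def by (rule smooth_on_cong[rotated]) (simp add: nonisotropic_vectors_iff pi'_pt)
    note tf = levi_civita_torsion_free[OF assms(1-3) this assms(4)]
    have "((\<lambda>z. inner (pi' (pt z) v) e) has_derivative
      (\<lambda>h. inner (inverse (quad v) *\<^sub>R (v \<cdot> \<langle>h, v\<rangle> + h \<cdot> \<langle>v, v\<rangle>)
        + (- (inverse (quad v) * (2 * re_form v h) * inverse (quad v))) *\<^sub>R (v \<cdot> \<langle>v, v\<rangle>)) e)) (at v)"
      by (rule has_derivative_transform_nonisotropic[OF has_derivative_inner_left[OF projection_has_derivative] assms(4)])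
        (simp_all add: assms(4) pi'_pt)
    from deriv_along_pt[OF this quad_nonzero_imp[OF assms(4)] tangent_imp_Lin[OF T]]
    have "deriv_along (pt v) T ?f = inner (T v) e"
      using assms(4) by (simp add: T0 smul.zero_right form_self smul_scaleR_right)
    with tf show ?thesis
      unfolding T_def[abs_def, symmetric]
      by (simp only: deriv_along_deriv_along_projection[OF assms(2,3,4), of e]
        deriv_along_deriv_along_projection[OF assms(3,2,4), of e] d_def d'_def inner_diff_left)
  qed
  then have "T v = (d + inverse (quad v) *\<^sub>R (v \<cdot> \<langle>d, v\<rangle>)) - (d' + inverse (quad v) *\<^sub>R (v \<cdot> \<langle>d', v\<rangle>))"
    by (metis inner_commute vector_eq_rdot)
  also have "\<dots> = d - d' + v \<cdot> (inverse (quad v) *\<^sub>R (\<langle>d, v\<rangle> - \<langle>d', v\<rangle>))"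
    by (simp add: smul_scaleR_right smul.diff_right scaleR_diff_right)
  finally have "pi (pt v) (T v) = pi (pt v) d - pi (pt v) d'"
    by (simp only: pi_add[OF assms(4)] pi_diff[OF assms(4)] pi_smul_self[OF assms(4)]) simp
  moreover have "pi (pt v) (T v) = T v"
    using tangent_orthogonal[OF assms(4) T] assms(4) by (simp add: pi_orthogonal)
  ultimately show ?thesis by (simp add: T_def flat_connection_def d_def d'_def)
qed

text \<open>
  Both sides are, up to the same factor, the derivative along \<open>X\<close> of
  \<open>metric \<sigma> Y Z\<close>: the left one by compatibility of \<open>nabla\<close> with the metric, the right
  one by the product rule for \<open>re_form (Y v) (Z v) / quad v\<close>.
\<close>
lemma metric_flat_connection:
  assumes "levi_civita \<sigma> nabla" "\<sigma> \<noteq> 0" "vector_field X" "vector_field Y" "vector_field Z" "quad v \<noteq> 0"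
  shows "re_form (nabla X Y (pt v) v) (Z (pt v) v) + re_form (Y (pt v) v) (nabla X Z (pt v) v) =
    re_form (flat_connection X Y v) (Z (pt v) v) + re_form (Y (pt v) v) (flat_connection X Z v)"
proof -
  note T = vector_field_tangent[OF _ assms(6)]
  define Xv where "Xv = X (pt v) v"
  have X0: "\<langle>v, Xv\<rangle> = 0" "re_form v Xv = 0"
    using tangent_orthogonal[OF assms(6) T[OF assms(3)], of v] by (simp_all add: Xv_def re_form_def)
  have YZ0: "\<langle>v, Y (pt v) v\<rangle> = 0" "\<langle>v, Z (pt v) v\<rangle> = 0" "Y (pt v) Xv = 0" "Z (pt v) Xv = 0"
    using tangent_orthogonal[OF assms(6) T[OF assms(4)], of v] tangent_orthogonal[OF assms(6) T[OF assms(5)], of v]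
      tangent_kernel[OF assms(6) T[OF assms(4)] X0(1)] tangent_kernel[OF assms(6) T[OF assms(5)] X0(1)]
    by simp_all
  define Y' where "Y' h = flat_derivative Y v h v + Y (pt v) h" for h
  define Z' where "Z' h = flat_derivative Z v h v + Z (pt v) h" for h
  define D where "D h = \<sigma> * (inverse (quad v) * (re_form (Y (pt v) v) (Z' h) + re_form (Y' h) (Z (pt v) v))
    + - (inverse (quad v) * (2 * re_form v h) * inverse (quad v)) * re_form (Y (pt v) v) (Z (pt v) v))" for h
  have "((\<lambda>z. \<sigma> * (inverse (quad z) * re_form (Y (pt z) z) (Z (pt z) z))) has_derivative D) (at v)"
    unfolding D_def Y'_def Z'_def
    by (intro has_derivative_mult_right has_derivative_mult Deriv.has_derivative_inverse assms(6) has_derivative_quad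
        re_form.FDERIV vector_field_at_vector_has_derivative assms(4,5))
  then have "((\<lambda>z. metric \<sigma> (Y (pt z)) (Z (pt z))) has_derivative D) (at v)"
    by (rule has_derivative_transform_nonisotropic[OF _ assms(6)])
      (simp add: metric_tangent vector_field_tangent assms(4,5) divide_inverse mult.commute)
  from deriv_along_pt[OF this quad_nonzero_imp[OF assms(6)] tangent_imp_Lin[OF T[OF assms(3)]]]
  have "D Xv = metric \<sigma> (nabla X Y (pt v)) (Z (pt v)) + metric \<sigma> (Y (pt v)) (nabla X Z (pt v))"
    using levi_civita_metric[OF assms(1,3,4,5,6)] by (simp add: Xv_def)
  also have "\<dots> = \<sigma> * inverse (quad v) *
    (re_form (nabla X Y (pt v) v) (Z (pt v) v) + re_form (Y (pt v) v) (nabla X Z (pt v) v))"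
    using assms by (simp add: metric_tangent[OF assms(6)] T levi_civita_vector_field divide_inverse algebra_simps)
  also have "D Xv = \<sigma> * inverse (quad v) *
    (re_form (flat_connection X Y v) (Z (pt v) v) + re_form (Y (pt v) v) (flat_connection X Z v))"
    using re_form_orthogonal_pi[OF assms(6) YZ0(1)] re_form_orthogonal_pi[OF assms(6) YZ0(2)]
    by (simp add: D_def X0 Y'_def Z'_def YZ0 flat_connection_def Xv_def[symmetric] re_form_commute[of _ "Z (pt v) v"]
        algebra_simps)
  finally show ?thesis using assms(2,6) by simp
qed

text \<open>
  Let \<open>B(X, Y, Z)\<close> be the pairing of the difference of the two connections with \<open>Z\<close>. It
  is symmetric in \<open>X, Y\<close> and skew in \<open>Y, Z\<close>, hence zero. As \<open>Z\<close> can be any extension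
  of any tangent vector, the difference vanishes.
\<close>
lemma levi_civita_eq_flat_connection:
  assumes "levi_civita \<sigma> nabla" "\<sigma> \<noteq> 0" "vector_field X" "vector_field Y" "quad v \<noteq> 0"
  shows "nabla X Y (pt v) v = flat_connection X Y v"
proof -
  define A where "A X Y = nabla X Y (pt v) v - flat_connection X Y v" for X Y
  have sym: "A X Y = A Y X" if "vector_field X" "vector_field Y" for X Y
    using torsion_free_flat_connection[OF assms(1) that assms(5)]
    by (simp add: A_def algebra_simps)
  have skew: "re_form (A X Y) (Z (pt v) v) = - re_form (A X Z) (Y (pt v) v)"
    if "vector_field X" "vector_field Y" "vector_field Z" for X Y Z
    using metric_flat_connection[OF assms(1,2) that assms(5)]
    by (simp add: A_def re_form.diff_left re_form_commute[of "Y (pt v) v"])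
  \<comment> \<open>The alternating chain \<open>B(X,Y,Z) = - B(X,Z,Y) = - B(Z,X,Y) = B(Z,Y,X) = B(Y,Z,X) = - B(Y,X,Z) = - B(X,Y,Z)\<close>.\<close>
  have zero: "re_form (A X Y) (Z (pt v) v) = 0" if "vector_field Z" for Z
    using skew[of X Y Z] skew[of Z X Y] skew[of Y Z X] sym[of X Y] sym[of X Z] sym[of Y Z]
      assms(3,4) that by simp
  have orth: "\<langle>v, A X Y\<rangle> = 0"
    using tangent_orthogonal[OF assms(5) vector_field_tangent[OF levi_civita_vector_field[OF assms(1,3,4)] assms(5)]]
      form_pi[OF assms(5)]
    by (simp add: A_def form.diff_right flat_connection_def)
  have "A X Y = 0"
  proof (rule re_form_nondegenerate)
    fix e
    have "re_form (A X Y) (tang (rank_one v e) (pt v) v) = 0"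
      by (rule zero) (rule vector_field_tang[OF rank_one_Lin])
    then show "re_form (A X Y) e = 0"
      using assms(5) orth by (simp add: tang_self rank_one_Lin rank_one_self re_form_orthogonal_pi)
  qed
  then show ?thesis by (simp add: A_def)
qed

section \<open>Covariant derivatives along a curve\<close>
lemma velocity_eq:
  assumes "quad (\<gamma> s) \<noteq> 0"
  shows "velocity a b \<gamma> s = rank_one (\<gamma> s) (pi (pt (\<gamma> s)) (vector_derivative \<gamma> (at s within {a..b})))"
  by (intro ext) (simp add: velocity_def rank_one_def form_self divide_inverse inverse_scaleR_distrib smul_scaleR_right)

text \<open>
  Lifts of vector fields are constant in the directions \<open>v \<cdot> k\<close>, so the derivative along a
  curve of vectors and that along the velocity of the curve of points agree.
\<close>
lemma flat_derivative_pi: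
  assumes "vector_field Y" "quad v \<noteq> 0"
  shows "flat_derivative Y v (pi (pt v) h) u = flat_derivative Y v h u"
proof -
  note D = vector_field_has_derivative[OF assms, of u]
  have "linear (\<lambda>h. flat_derivative Y v h u)"
    using has_derivative_bounded_linear[OF D] by (rule bounded_linear.linear)
  moreover have "pi (pt v) h = h - v \<cdot> (inverse (quad v) *\<^sub>R \<langle>v, h\<rangle>)"
    using assms(2) by (simp add: pi_pt smul_scaleR_right)
  ultimately show ?thesis
    using linear_diff[of "\<lambda>h. flat_derivative Y v h u"] has_derivative_pt_radial[where F = "\<lambda>x. Y x u", OF D]
    by simp
qed

text \<open>
  The covariant derivative of a field along a curve is the tangential part of its derivative as a
  curve of endomorphisms. For a restricted vector field this is the chain rule together with the
  explicit form of the connection; the general case follows by linearity and the Leibniz rule.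
\<close>
lemma has_covariant_derivative_imp:
  assumes "levi_civita \<sigma> nabla" "\<sigma> \<noteq> 0"
    and s: "s \<in> {a..b}" and q: "quad (\<gamma> s) \<noteq> 0"
    and \<gamma>: "\<gamma> differentiable (at s within {a..b})"
    and cov: "has_covariant_derivative nabla a b \<gamma> T D s"
  obtains T' where "\<And>u. ((\<lambda>r. T r u) has_vector_derivative T' u) (at s within {a..b})"
    and "D (\<gamma> s) = pi (pt (\<gamma> s)) (T' (\<gamma> s))"
proof -
  define \<gamma>' where "\<gamma>' = vector_derivative \<gamma> (at s within {a..b})"
  have \<gamma>': "(\<gamma> has_vector_derivative \<gamma>') (at s within {a..b})"
    using \<gamma> unfolding \<gamma>'_def by (simp add: vector_derivative_works)
  obtain n :: nat and X c c' Y where expansion: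
    "(\<forall>j<n. vector_field (X j) \<and> (c j has_real_derivative c' j) (at s within {a..b})) \<and>
      (\<forall>r\<in>{a..b}. \<forall>v. T r v = (\<Sum>j<n. c j r *\<^sub>R X j (pt (\<gamma> r)) v)) \<and>
      vector_field Y \<and> Y (pt (\<gamma> s)) = velocity a b \<gamma> s \<and>
      (\<forall>v. D v = (\<Sum>j<n. c' j *\<^sub>R X j (pt (\<gamma> s)) v + c j s *\<^sub>R nabla Y (X j) (pt (\<gamma> s)) v))"
    using cov unfolding has_covariant_derivative_def by (elim exE) (rule that)
  have X: "vector_field (X j)" and c: "(c j has_real_derivative c' j) (at s within {a..b})" if "j < n" for j
    using expansion that by simp_all
  have T: "T r v = (\<Sum>j<n. c j r *\<^sub>R X j (pt (\<gamma> r)) v)" if "r \<in> {a..b}" for r v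
    using expansion that by simp
  have Y: "vector_field Y" "Y (pt (\<gamma> s)) = velocity a b \<gamma> s"
    using expansion by simp_all
  have D: "D v = (\<Sum>j<n. c' j *\<^sub>R X j (pt (\<gamma> s)) v + c j s *\<^sub>R nabla Y (X j) (pt (\<gamma> s)) v)" for v
    using expansion by simp
  define T' where "T' u = (\<Sum>j<n. c j s *\<^sub>R flat_derivative (X j) (\<gamma> s) \<gamma>' u + c' j *\<^sub>R X j (pt (\<gamma> s)) u)" for u
  have "((\<lambda>r. T r u) has_vector_derivative T' u) (at s within {a..b})" for u
  proof -
    have "((\<lambda>r. X j (pt (\<gamma> r)) u) has_vector_derivative flat_derivative (X j) (\<gamma> s) \<gamma>' u) (at s within {a..b})"
      if "j < n" for j
      using vector_derivative_diff_chain_within[OF \<gamma>' has_derivative_at_withinI[OF vector_field_has_derivative[OF X[OF that] q]]]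
      by (simp add: o_def)
    then have "((\<lambda>r. \<Sum>j<n. c j r *\<^sub>R X j (pt (\<gamma> r)) u) has_vector_derivative T' u) (at s within {a..b})"
      unfolding T'_def using c by (intro has_vector_derivative_sum has_vector_derivative_scaleR) auto
    then show ?thesis
      by (rule has_vector_derivative_transform[OF s, rotated]) (rule T)
  qed
  moreover have "D (\<gamma> s) = pi (pt (\<gamma> s)) (T' (\<gamma> s))"
  proof -
    have Yv: "Y (pt (\<gamma> s)) (\<gamma> s) = pi (pt (\<gamma> s)) \<gamma>'"
      by (simp add: Y(2) velocity_eq q rank_one_self \<gamma>'_def)
    have "nabla Y (X j) (pt (\<gamma> s)) (\<gamma> s) = pi (pt (\<gamma> s)) (flat_derivative (X j) (\<gamma> s) \<gamma>' (\<gamma> s))"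
      if "j < n" for j
      using levi_civita_eq_flat_connection[OF assms(1,2) Y(1) X[OF that] q]
      by (simp add: flat_connection_def Yv flat_derivative_pi X[OF that] q)
    moreover have "pi (pt (\<gamma> s)) (X j (pt (\<gamma> s)) (\<gamma> s)) = X j (pt (\<gamma> s)) (\<gamma> s)" if "j < n" for j
      using tangent_orthogonal[OF q vector_field_tangent[OF X[OF that] q]] q by (simp add: pi_orthogonal)
    ultimately show ?thesis
      unfolding D T'_def linear_sum[OF linear_pi[OF q]]
      by (intro sum.cong refl) (simp add: pi_add pi_scaleR q add.commute)
  qed
  ultimately show thesis by (rule that)
qed

text \<open>
  Conversely, a differentiable field is a combination of restricted vector fields, with the rank one
  maps \<open>u \<mapsto> b \<cdot> \<langle>b', u\<rangle>\<close> for real basis vectors \<open>b\<close>, \<open>b'\<close> as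
  generators: the coefficients come from expanding both \<open>T \<gamma>\<close> and \<open>\<gamma>\<close> in
  \<open>T u = T \<gamma> \<cdot> \<langle>\<gamma>, u\<rangle> / \<langle>\<gamma>, \<gamma>\<rangle>\<close>. That the resulting covariant
  derivative is \<open>D\<close> follows from the preceding lemma.
\<close>
lemma has_covariant_derivativeI:
  assumes "levi_civita \<sigma> nabla" "\<sigma> \<noteq> 0" "a < b"
    and s: "s \<in> {a..b}" and q: "\<And>r. r \<in> {a..b} \<Longrightarrow> quad (\<gamma> r) \<noteq> 0"
    and \<gamma>: "\<gamma> differentiable (at s within {a..b})"
    and T: "\<And>r. r \<in> {a..b} \<Longrightarrow> T r \<in> tangent (pt (\<gamma> r))"
    and T': "\<And>u. ((\<lambda>r. T r u) has_vector_derivative T' u) (at s within {a..b})"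
    and D: "D \<in> tangent (pt (\<gamma> s))" "D (\<gamma> s) = pi (pt (\<gamma> s)) (T' (\<gamma> s))"
  shows "has_covariant_derivative nabla a b \<gamma> T D s"
proof -
  define E where "E x u = fst x \<cdot> \<langle>snd x, u\<rangle>" for x u
  define C where "C x r = inner (T r (\<gamma> r)) (fst x) * inner (\<gamma> r) (snd x) * inverse (quad (\<gamma> r))" for x r
  have E: "E x \<in> Lin" for x
    by (simp add: Lin_def E_def form_add_right smul_add_right form_smul_right smul_mult)
  have T_basis: "T r (\<gamma> r) = (\<Sum>b\<in>Basis. inner (\<gamma> r) b *\<^sub>R T r b)" if "r \<in> {a..b}" for r
  proof -
    have "linear (T r)"
      by (rule bounded_linear.linear) (intro Lin_imp_bounded_linear tangent_imp_Lin[OF T[OF that]])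
    then have "T r (\<Sum>b\<in>Basis. inner (\<gamma> r) b *\<^sub>R b) = (\<Sum>b\<in>Basis. inner (\<gamma> r) b *\<^sub>R T r b)"
      by (simp add: linear_sum linear_scale)
    then show ?thesis by (simp add: euclidean_representation)
  qed
  have T_expand: "T r u = (\<Sum>x\<in>Basis \<times> Basis. C x r *\<^sub>R tang (E x) (pt (\<gamma> r)) u)" if r: "r \<in> {a..b}" for r u
  proof -
    have "(\<Sum>x\<in>Basis \<times> Basis. C x r *\<^sub>R E x w) = T r w" for w
    proof -
      have "(\<Sum>x\<in>Basis \<times> Basis. C x r *\<^sub>R E x w) = inverse (quad (\<gamma> r)) *\<^sub>R
        ((\<Sum>b\<in>Basis. inner (T r (\<gamma> r)) b *\<^sub>R b) \<cdot> \<langle>\<Sum>b\<in>Basis. inner (\<gamma> r) b *\<^sub>R b, w\<rangle>)"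
      proof -
        have "(\<Sum>x\<in>Basis \<times> Basis. C x r *\<^sub>R E x w) = (\<Sum>b\<in>Basis. \<Sum>b'\<in>Basis. C (b, b') r *\<^sub>R E (b, b') w)"
          by (simp add: sum.cartesian_product split_def)
        also have "\<dots> = (\<Sum>b\<in>Basis. (inner (T r (\<gamma> r)) b * inverse (quad (\<gamma> r))) *\<^sub>R
            (b \<cdot> (\<Sum>b'\<in>Basis. inner (\<gamma> r) b' *\<^sub>R \<langle>b', w\<rangle>)))"
          by (simp add: C_def E_def smul.sum_right smul_scaleR_right scaleR_sum_right mult_ac)
        also have "\<dots> = inverse (quad (\<gamma> r)) *\<^sub>R ((\<Sum>b\<in>Basis. inner (T r (\<gamma> r)) b *\<^sub>R b)
            \<cdot> (\<Sum>b'\<in>Basis. inner (\<gamma> r) b' *\<^sub>R \<langle>b', w\<rangle>))"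
          by (simp only: smul.sum_left smul_scaleR_left scaleR_sum_right scaleR_scaleR mult.commute)
        finally show ?thesis by (simp only: form.sum_left form_scaleR_left)
      qed
      then show ?thesis
        using tangent_apply[OF q[OF r] T[OF r], of w] by (simp add: euclidean_representation)
    qed
    then have "T r u = tang (\<lambda>w. \<Sum>x\<in>Basis \<times> Basis. C x r *\<^sub>R E x w) (pt (\<gamma> r)) u"
      using tang_of_tangent[OF q[OF r] T[OF r]] by simp
    then show ?thesis
      using q[OF r] by (simp add: tang_def pi_scaleR linear_sum[OF linear_pi])
  qed
  have C: "\<exists>d. (C x has_real_derivative d) (at s within {a..b})" for x
  proof -
    have "(\<lambda>r. \<Sum>b\<in>Basis. inner (\<gamma> r) b *\<^sub>R T r b) differentiable (at s within {a..b})"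
      using \<gamma> differentiableI_vector[OF T']
      by (intro differentiable_sum ballI differentiable_scaleR differentiable_inner differentiable_const) auto
    then have "(\<lambda>r. T r (\<gamma> r)) differentiable (at s within {a..b})"
      unfolding differentiable_def
      using has_derivative_transform[OF s, of "\<lambda>r. T r (\<gamma> r)", OF T_basis] by blast
    moreover have "(\<lambda>r. quad (\<gamma> r)) differentiable (at s within {a..b})"
      using \<gamma> unfolding differentiable_def by (blast intro: has_derivative_compose[OF _ has_derivative_quad])
    ultimately have "C x differentiable (at s within {a..b})"
      unfolding C_def[abs_def] using \<gamma> q[OF s]
      by (intro differentiable_mult differentiable_inner differentiable_inverse differentiable_const)
    then show ?thesis by (simp add: real_differentiable_def)
  qed
  define N where "N = card (Basis \<times> Basis :: ('v \<times> 'v) set)"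
  obtain e where e: "bij_betw e {..<N} (Basis \<times> Basis :: ('v \<times> 'v) set)"
    unfolding N_def using ex_bij_betw_nat_finite[of "Basis \<times> Basis :: ('v \<times> 'v) set"]
    by (auto simp: lessThan_atLeast0)
  obtain C' where C': "\<And>x. (C x has_real_derivative C' x) (at s within {a..b})"
    using C by metis
  define Y where "Y = tang (velocity a b \<gamma> s)"
  have v: "velocity a b \<gamma> s \<in> tangent (pt (\<gamma> s))"
    by (simp add: velocity_eq q[OF s] rank_one_tangent form_pi)
  have Y: "vector_field Y" "Y (pt (\<gamma> s)) = velocity a b \<gamma> s"
    unfolding Y_def using v by (simp_all add: vector_field_tang[OF tangent_imp_Lin] tang_of_tangent[OF q[OF s]])
  \<comment> \<open>The covariant derivative that the Leibniz rule assigns to this expansion.\<close>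
  define D0 where "D0 u = (\<Sum>j<N. C' (e j) *\<^sub>R tang (E (e j)) (pt (\<gamma> s)) u
      + C (e j) s *\<^sub>R nabla Y (tang (E (e j))) (pt (\<gamma> s)) u)" for u
  have D0: "has_covariant_derivative nabla a b \<gamma> T D0 s"
    unfolding has_covariant_derivative_def
  proof (intro exI conjI)
    show "\<forall>j<N. vector_field (tang (E (e j))) \<and> (C (e j) has_real_derivative C' (e j)) (at s within {a..b})"
      using C' vector_field_tang[OF E] by blast
    show "\<forall>r\<in>{a..b}. \<forall>v. T r v = (\<Sum>j<N. C (e j) r *\<^sub>R tang (E (e j)) (pt (\<gamma> r)) v)"
    proof (intro ballI allI)
      fix r u assume "r \<in> {a..b}"
      from T_expand[OF this, of u]
      show "T r u = (\<Sum>j<N. C (e j) r *\<^sub>R tang (E (e j)) (pt (\<gamma> r)) u)"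
        by (simp only: sum.reindex_bij_betw[OF e, where g = "\<lambda>x. C x r *\<^sub>R tang (E x) (pt (\<gamma> r)) u"])
    qed
    show "\<forall>u. D0 u = (\<Sum>j<N. C' (e j) *\<^sub>R tang (E (e j)) (pt (\<gamma> s)) u
        + C (e j) s *\<^sub>R nabla Y (tang (E (e j))) (pt (\<gamma> s)) u)"
      by (simp add: D0_def)
  qed (rule Y)+
  obtain T'' where T'': "\<And>u. ((\<lambda>r. T r u) has_vector_derivative T'' u) (at s within {a..b})"
    "D0 (\<gamma> s) = pi (pt (\<gamma> s)) (T'' (\<gamma> s))"
    using has_covariant_derivative_imp[OF assms(1,2) s q[OF s] \<gamma> D0] by metis
  have "T'' u = T' u" for u
    using vector_derivative_unique_interval[OF assms(3) s T''(1) T'] .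
  then have "D0 (\<gamma> s) = D (\<gamma> s)" using T''(2) D(2) by simp
  moreover have "D0 \<in> tangent (pt (\<gamma> s))"
    unfolding D0_def[abs_def] sum.distrib
    by (intro tangent_add tangent_sum q[OF s] finite_lessThan tang_tangent E vector_field_tangent
        levi_civita_vector_field[OF assms(1)] Y(1) vector_field_tang)
  ultimately have "D0 = D"
    using tangent_ext[OF q[OF s]] D(1) by blast
  then show ?thesis using D0 by simp
qed

lemma parallel_along_iff:
  assumes "levi_civita \<sigma> nabla" "\<sigma> \<noteq> 0" "a < b"
    and quad_\<gamma>: "\<forall>r\<in>{a..b}. quad (\<gamma> r) \<noteq> 0" and \<gamma>: "\<gamma> differentiable_on {a..b}"
  shows "parallel_along nabla a b \<gamma> T \<longleftrightarrow> (\<forall>s\<in>{a..b}. T s \<in> tangent (pt (\<gamma> s)) \<and>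
    (\<exists>T'. (\<forall>u. ((\<lambda>r. T r u) has_vector_derivative T' u) (at s within {a..b})) \<and> pi (pt (\<gamma> s)) (T' (\<gamma> s)) = 0))"
    (is "_ \<longleftrightarrow> ?R")
proof
  have q: "quad (\<gamma> r) \<noteq> 0" if "r \<in> {a..b}" for r
    using quad_\<gamma> that by blast
  have d: "\<gamma> differentiable (at s within {a..b})" if "s \<in> {a..b}" for s
    using \<gamma> that by (simp add: differentiable_on_def)
  {
    assume "parallel_along nabla a b \<gamma> T"
    then show ?R
      unfolding parallel_along_def
      using has_covariant_derivative_imp[OF assms(1,2) _ q d] by metis
  next
    assume ?R
    have "has_covariant_derivative nabla a b \<gamma> T (\<lambda>v. 0) s" if s: "s \<in> {a..b}" for s
    proof -
      obtain T' where T': "\<And>u. ((\<lambda>r. T r u) has_vector_derivative T' u) (at s within {a..b})"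
        "pi (pt (\<gamma> s)) (T' (\<gamma> s)) = 0"
        using \<open>?R\<close> s by blast
      have "(\<lambda>v. 0) \<in> tangent (pt (\<gamma> s))"
        using tangent_sum[of "{}" "\<gamma> s"] q[OF s] by simp
      then show ?thesis
        using T' \<open>?R\<close> s by (intro has_covariant_derivativeI[OF assms(1-3) s q d]) auto
    qed
    then show "parallel_along nabla a b \<gamma> T"
      using \<open>?R\<close> by (simp add: parallel_along_def)
  }
qed

section \<open>Geodesics and parallel fields on euclidean lines\<close>
lemma Lin_projections:
  assumes "quad v \<noteq> 0" "quad w \<noteq> 0" "t \<in> Lin"
  shows "pi (pt v) \<circ> pi' (pt w) \<circ> t \<in> Lin"
proof -
  have "pi' (pt w) = (\<lambda>x. x - pi (pt w) x)"
    by (auto simp: pi_def)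
  then show ?thesis
    using assms by (simp add: Lin_def pi_add pi_smul pi_diff smul.diff_left)
qed

lemma Eu_tangent:
  assumes "quad v \<noteq> 0" "quad w \<noteq> 0" "t \<in> Lin"
  shows "Eu (pt v) t (pt w) \<in> tangent (pt w)"
  unfolding Eu_def
  by (intro tangent_add tangent_scaleR tang_tangent Lin_projections assms)

text \<open>
  The null vector \<open>u\<close> is orthogonal to both points, so \<open>t\<close> takes the same value at both
  representatives and the projections of that value involve only \<open>c = \<langle>u, t v\<rangle>\<close>.
\<close>
lemma Eu_on_euclidean_line:
  assumes v: "quad v \<noteq> 0" and u: "\<langle>v, u\<rangle> = 0" "\<langle>u, u\<rangle> = 0" and t: "t \<in> tangent (pt v)"
  shows "Eu (pt v) t (pt (v + u)) (v + u) =
    t v - inverse (quad v) *\<^sub>R ((v + (1 / 2) *\<^sub>R u) \<cdot> \<langle>u, t v\<rangle>)"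
proof -
  have u': "\<langle>u, v\<rangle> = 0" using u(1) by (simp add: form_eq_0_commute)
  have q: "quad (v + u) = quad v"
    using u u' by (simp add: quad_def re_form_def form_add_left form_add_right)
  have qw: "quad (v + u) \<noteq> 0" using v q by simp
  define c where "c = \<langle>u, t v\<rangle>"
  have tw: "t (v + u) = t v"
    using Lin_add[OF tangent_imp_Lin[OF t]] tangent_kernel[OF v t u(1)] by simp
  have w: "\<langle>v + u, t v\<rangle> = c"
    using tangent_orthogonal[OF v t] by (simp add: form_add_left c_def)
  have "pi (pt (v + u)) (t v) = t v - inverse (quad v) *\<^sub>R ((v + u) \<cdot> c)"
    by (simp add: pi_pt v q w)
  moreover have "pi (pt v) (pi' (pt (v + u)) (t v)) = inverse (quad v) *\<^sub>R (u \<cdot> c)"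
  proof -
    have "pi' (pt (v + u)) (t v) = (v + u) \<cdot> (inverse (quad v) *\<^sub>R c)"
      by (simp add: pi'_pt v q w smul_scaleR_right)
    then have "pi (pt v) (pi' (pt (v + u)) (t v)) = (pi (pt v) v + pi (pt v) u) \<cdot> (inverse (quad v) *\<^sub>R c)"
      using v by (simp add: pi_smul pi_add)
    then show ?thesis
      using v u pi_smul_self[OF v, of 1] by (simp add: pi_orthogonal smul_scaleR_right)
  qed
  moreover have "pi (pt (v + u)) (u \<cdot> k) = u \<cdot> k" for k
    using u u' by (simp add: pi_orthogonal qw form_smul_right form_add_left)
  ultimately have "Eu (pt v) t (pt (v + u)) (v + u) =
      (1 / 2) *\<^sub>R (inverse (quad v) *\<^sub>R (u \<cdot> c)) + (t v - inverse (quad v) *\<^sub>R ((v + u) \<cdot> c))"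
    using tang_self[OF qw Lin_projections[OF v qw tangent_imp_Lin[OF t]]] tang_self[OF qw tangent_imp_Lin[OF t]]
    by (simp add: Eu_def tw pi_scaleR[OF qw])
  also have "\<dots> = t v - inverse (quad v) *\<^sub>R ((v + (1 / 2) *\<^sub>R u) \<cdot> c)"
  proof -
    define x where "x = inverse (quad v) *\<^sub>R (u \<cdot> c)"
    have "x = (1 / 2) *\<^sub>R x + (1 / 2) *\<^sub>R x" by (simp flip: scaleR_add_left)
    moreover have "inverse (quad v) *\<^sub>R ((v + r *\<^sub>R u) \<cdot> c) = inverse (quad v) *\<^sub>R (v \<cdot> c) + r *\<^sub>R x" for r
      by (simp add: x_def smul_add_left smul_scaleR_left scaleR_add_right mult.commute)
    from this[of 1] this[of "1 / 2"] calculation show ?thesis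
      unfolding x_def[symmetric] by (simp add: algebra_simps)
  qed
  finally show ?thesis by (simp add: c_def)
qed

text \<open>
  The circle is the projectivization of a real plane \<open>W\<close> that contains representatives of
  both points, with real product; a real multiple of the second one differs from the first one,
  \<open>v\<close>, by a vector \<open>u\<close> orthogonal to it. Since the form restricted to the line has a kernel
  and \<open>v\<close> is nonisotropic, \<open>u\<close> spans that kernel. As \<open>W\<close> is the real span of
  \<open>v\<close> and \<open>u\<close>, the parameter \<open>f\<close> is real. That \<open>f\<close> is real makes the
  integrand \<open>(v + f u) f'\<close> of the transport equation exact, so that the result depends only on
  the end points.
\<close>
lemma geodesic_on_euclidean_line:
  assumes "p \<in> nonisotropic" "q \<in> nonisotropic" "p \<noteq> q" "euclidean_line (line_through p q)"
    and seg: "parametrizes_segment p q a b \<gamma>"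
  obtains v u f where "p = pt v" "q = pt (v + u)" "quad v \<noteq> 0" "\<langle>v, u\<rangle> = 0" "\<langle>u, u\<rangle> = 0"
    and "f a = (0::real)" "f b = 1" "\<And>s. s \<in> {a..b} \<Longrightarrow> f differentiable (at s within {a..b})"
    and "\<And>s. s \<in> {a..b} \<Longrightarrow> \<exists>k. k \<noteq> 0 \<and> \<gamma> s = (v + f s *\<^sub>R u) \<cdot> k"
proof -
  have ab: "a < b" and smooth: "smooth_on {a..b} \<gamma>" and nz: "\<And>s. s \<in> {a..b} \<Longrightarrow> \<gamma> s \<noteq> 0"
    and ends: "pt (\<gamma> a) = p" "pt (\<gamma> b) = q"
    and orth: "\<And>s. s \<in> {a..b} \<Longrightarrow> \<not> orthogonal_pts p (pt (\<gamma> s))"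
    using seg by (auto simp: parametrizes_segment_def)
  obtain C where C: "geodesic C" "\<And>s. s \<in> {a..b} \<Longrightarrow> pt (\<gamma> s) \<in> C"
    using seg by (auto simp: parametrizes_segment_def)
  obtain W where W: "subspace W" "dim W = 2" "\<And>x y. x \<in> W \<Longrightarrow> y \<in> W \<Longrightarrow> \<langle>x, y\<rangle> \<in> \<real>" "C = pt ` (W - {0})"
    using C(1) unfolding geodesic_def by blast
  have W_lift: "\<exists>x\<in>W. x \<noteq> 0 \<and> pt (\<gamma> s) = pt x" if "s \<in> {a..b}" for s
    using C(2)[OF that] W(4) by blast
  obtain v where v: "v \<in> W" "v \<noteq> 0" "p = pt v"
    using W_lift[of a] ab ends by auto
  obtain w where w: "w \<in> W" "w \<noteq> 0" "q = pt w"
    using W_lift[of b] ab ends by auto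
  have quad: "quad x \<noteq> 0" if x: "pt x \<in> nonisotropic" "x \<noteq> 0" for x
  proof -
    obtain y where y: "pt x = pt y" "quad y \<noteq> 0" by (rule nonisotropicE[OF x(1)])
    then obtain k where "k \<noteq> 0" "y = x \<cdot> k"
      using pt_eq_pt_iff[OF x(2) quad_nonzero_imp[OF y(2)]] by auto
    then show ?thesis using y(2) by (simp add: quad_smul)
  qed
  have qv: "quad v \<noteq> 0" using quad v assms(1) by blast
  have "\<langle>v, w\<rangle> \<noteq> 0"
    using orth[of b] ab ends v w orthogonal_pts_pt by auto
  moreover obtain c where c: "\<langle>v, w\<rangle> = c *\<^sub>R 1"
    using W(3)[OF v(1) w(1)] by (auto simp: Reals_def of_real_def)
  ultimately have c0: "c \<noteq> 0" by auto
  \<comment> \<open>The factor that makes the difference of the representatives orthogonal to \<open>v\<close>.\<close>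
  define d where "d = quad v / c"
  have d0: "d \<noteq> 0" using qv c0 by (simp add: d_def)
  define u where "u = d *\<^sub>R w - v"
  have w_eq: "w = (1 / d) *\<^sub>R (v + u)" using d0 by (simp add: u_def)
  have uW: "u \<in> W" unfolding u_def using W(1) v(1) w(1) by (simp add: subspace_diff subspace_scale)
  have vu: "\<langle>v, u\<rangle> = 0"
    using c0 by (simp add: u_def form.diff_right form_scaleR_right c form_self d_def)
  then have uv: "\<langle>u, v\<rangle> = 0" by (simp add: form_eq_0_commute)
  have "pt (d *\<^sub>R w) = pt w"
    using pt_smul[of "of_real d" w] d0 by (simp add: smul_of_real)
  then have q: "q = pt (v + u)" using w(3) by (simp add: u_def)
  have u0: "u \<noteq> 0" using q v(3) assms(3) by auto
  obtain n where n: "n \<in> line_through p q" "n \<noteq> 0" "\<And>x. x \<in> line_through p q \<Longrightarrow> \<langle>n, x\<rangle> = 0"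
    using assms(4) unfolding euclidean_line_def by blast
  have zero_pt: "0 \<in> pt x" for x
    unfolding pt_def using smul.zero_right by (metis rangeI)
  have line: "x + y \<in> line_through p q" if "x \<in> pt v" "y \<in> pt w" for x y
    using that v(3) w(3) by (auto simp: line_through_def)
  have v_line: "v \<in> line_through p q" and w_line: "w \<in> line_through p q"
    using line[OF mem_pt_self zero_pt] line[OF zero_pt mem_pt_self] by simp_all
  obtain k l where "n = v \<cdot> k + w \<cdot> l"
    using n(1) v(3) w(3) by (auto simp: line_through_def pt_def)
  then have n_eq: "n = v \<cdot> (k + (1 / d) *\<^sub>R l) + u \<cdot> ((1 / d) *\<^sub>R l)"
    by (simp add: w_eq smul_scaleR_left smul_scaleR_right smul_add_left smul_add_right scaleR_add_right)
  have "\<langle>v, n\<rangle> = 0" using n(3)[OF v_line] by (simp add: form_eq_0_commute)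
  then have "k + (1 / d) *\<^sub>R l = 0"
    using qv by (simp add: n_eq form_add_right form_smul_right vu form_self)
  then have n_eq': "n = u \<cdot> ((1 / d) *\<^sub>R l)" using n_eq by (simp add: smul.zero_right)
  have l: "hconj ((1 / d) *\<^sub>R l) \<noteq> 0"
    using n(2) n_eq' norm_hconj[of "(1 / d) *\<^sub>R l"] smul.zero_right by (metis norm_eq_zero)
  have "hconj ((1 / d) *\<^sub>R l) * \<langle>u, w\<rangle> = 0"
    using n(3)[OF w_line] unfolding n_eq' form_smul_left .
  then have "\<langle>u, w\<rangle> = 0" using l by (simp only: mult_eq_0_iff) simp
  then have uu: "\<langle>u, u\<rangle> = 0"
    by (subst (2) u_def) (simp add: form.diff_right form_scaleR_right uv)
  have "independent {u, v}"
  proof -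
    have "v \<notin> span {u}"
      using qv vu by (auto simp: span_singleton quad_def re_form_def form_scaleR_right form_scaleR_left)
    then have "independent (insert v {u})"
      using u0 by (intro independent_insertI) (auto simp: real_vector.independent_empty)
    then show ?thesis by (simp add: insert_commute)
  qed
  moreover have "u \<noteq> v" using vu qv by (auto simp: quad_def re_form_def)
  then have "card {u, v} = 2" by simp
  ultimately have span: "W \<subseteq> span {u, v}"
    using card_ge_dim_independent[of "{u, v}" W] uW v(1) W(2) by simp
  have \<gamma>_eq: "\<exists>\<beta> k. k \<noteq> 0 \<and> \<gamma> s = (v + \<beta> *\<^sub>R u) \<cdot> k" if s: "s \<in> {a..b}" for s
  proof -
    obtain x where x: "x \<in> W" "x \<noteq> 0" "pt (\<gamma> s) = pt x" using W_lift[OF s] by blast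
    obtain \<alpha> \<beta> where x_eq: "x = \<alpha> *\<^sub>R v + \<beta> *\<^sub>R u"
    proof -
      obtain \<beta> where "x - \<beta> *\<^sub>R u \<in> span {v}"
        using span x(1) span_breakdown_eq[of x u "{v}"] by blast
      then obtain \<alpha> where "x - \<beta> *\<^sub>R u = \<alpha> *\<^sub>R v" by (auto simp: span_singleton)
      then show thesis by (intro that[of \<alpha> \<beta>]) (simp add: algebra_simps)
    qed
    have "\<langle>v, x\<rangle> \<noteq> 0"
      using orth[OF s] x v orthogonal_pts_pt by auto
    then have \<alpha>: "\<alpha> \<noteq> 0"
      by (auto simp: x_eq form_add_right form_scaleR_right vu)
    obtain k where k: "k \<noteq> 0" "\<gamma> s = x \<cdot> k"
      using pt_eq_pt_iff[OF x(2) nz[OF s]] x(3) by auto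
    have "\<gamma> s = (v + (\<beta> / \<alpha>) *\<^sub>R u) \<cdot> (\<alpha> *\<^sub>R k)"
      using \<alpha> by (simp add: k(2) x_eq smul_scaleR_right smul_scaleR_left smul_add_left scaleR_add_right)
    then show ?thesis using k(1) \<alpha> by (intro exI[of _ "\<beta> / \<alpha>"] exI[of _ "\<alpha> *\<^sub>R k"]) simp
  qed
  \<comment> \<open>Rescaling the lift so that its component along \<open>v\<close> is \<open>1\<close> makes \<open>f u\<close>, hence \<open>f\<close>,
    a differentiable function of the parameter.\<close>
  define f where "f s = inner (\<gamma> s \<cdot> (quad v *\<^sub>R inverse \<langle>v, \<gamma> s\<rangle>) - v) u / inner u u" for s
  have form_v: "\<langle>v, (v + \<beta> *\<^sub>R u) \<cdot> k\<rangle> = quad v *\<^sub>R k" for \<beta> k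
    by (simp add: form_smul_right form_add_right form_scaleR_right vu form_self)
  have f_eq: "f s = \<beta>" if "\<gamma> s = (v + \<beta> *\<^sub>R u) \<cdot> k" "k \<noteq> 0" for s \<beta> k
    using that u0 qv
    by (simp add: f_def form_v inverse_scaleR_distrib smul_mult[symmetric])
  show thesis
  proof (rule that[of v u f])
    show "p = pt v" "q = pt (v + u)" "quad v \<noteq> 0" "\<langle>v, u\<rangle> = 0" "\<langle>u, u\<rangle> = 0"
      by (fact v(3) q qv vu uu)+
    have "v + u \<noteq> 0" using w(2) d0 by (simp add: u_def)
    obtain k where "k \<noteq> 0" "\<gamma> a = v \<cdot> k"
      using pt_eq_pt_iff[OF v(2) nz[of a]] ab ends v(3) by auto
    then show "f a = 0" using f_eq[of a 0 k] by simp
    obtain k where "k \<noteq> 0" "\<gamma> b = (v + u) \<cdot> k"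
      using pt_eq_pt_iff[OF \<open>v + u \<noteq> 0\<close> nz[of b]] ab ends q by auto
    then show "f b = 1" using f_eq[of b 1 k] by simp
    fix s assume s: "s \<in> {a..b}"
    then show "\<exists>k. k \<noteq> 0 \<and> \<gamma> s = (v + f s *\<^sub>R u) \<cdot> k"
      using \<gamma>_eq f_eq by metis
    have "C_k (Suc 0) {a..b} \<gamma>" using smooth by (simp add: smooth_on_def)
    then have \<gamma>: "\<gamma> differentiable (at s within {a..b})"
      using s by (simp add: differentiable_on_def)
    then obtain \<gamma>' where \<gamma>': "(\<gamma> has_derivative \<gamma>') (at s within {a..b})" by (auto simp: differentiable_def)
    obtain \<beta> k where "k \<noteq> 0" "\<gamma> s = (v + \<beta> *\<^sub>R u) \<cdot> k" using \<gamma>_eq[OF s] by blast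
    then have "\<langle>v, \<gamma> s\<rangle> \<noteq> 0" using qv by (simp add: form_v)
    moreover have "((\<lambda>s. \<langle>v, \<gamma> s\<rangle>) has_derivative (\<lambda>h. \<langle>v, \<gamma>' h\<rangle>)) (at s within {a..b})"
      using has_derivative_compose[OF \<gamma>' bounded_linear_imp_has_derivative[OF form.bounded_linear_right]] .
    ultimately have "\<exists>D. ((\<lambda>s. \<gamma> s \<cdot> (quad v *\<^sub>R inverse \<langle>v, \<gamma> s\<rangle>)) has_derivative D) (at s within {a..b})"
      by (intro exI) (rule smul.FDERIV[OF \<gamma>' has_derivative_scaleR_right[OF Deriv.has_derivative_inverse]])
    then show "f differentiable (at s within {a..b})"
      unfolding f_def[abs_def] divide_inverse
      by (intro differentiable_mult differentiable_inner differentiable_diff differentiable_const)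
        (simp add: differentiable_def)
  qed
qed

text \<open>
  The equation \<open>w' = - \<delta> f' c / quad v\<close> for \<open>w = T \<delta>\<close> is integrated explicitly by
  \<open>sol\<close>. This gives uniqueness, and \<open>sol\<close> itself yields a parallel field.
\<close>
lemma parallel_transport_on_euclidean_line:
  fixes k :: "real \<Rightarrow> 'k"
  assumes lc: "levi_civita \<sigma> nabla" "\<sigma> \<noteq> 0" and ab: "a < b"
    and v: "quad v \<noteq> 0" and u: "\<langle>v, u\<rangle> = 0" "\<langle>u, u\<rangle> = 0"
    and f: "f a = (0::real)" "f b = 1" "\<And>s. s \<in> {a..b} \<Longrightarrow> f differentiable (at s within {a..b})"
    and \<gamma>: "\<gamma> differentiable_on {a..b}"
    and k: "\<And>s. s \<in> {a..b} \<Longrightarrow> k s \<noteq> 0" "\<And>s. s \<in> {a..b} \<Longrightarrow> \<gamma> s = (v + f s *\<^sub>R u) \<cdot> k s"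
    and t: "t \<in> tangent (pt v)"
  shows "is_parallel_transport nabla a b \<gamma> t t' \<longleftrightarrow>
    t' \<in> tangent (pt (v + u)) \<and>
    t' (v + u) = t v - inverse (quad v) *\<^sub>R ((v + (1 / 2) *\<^sub>R u) \<cdot> \<langle>u, t v\<rangle>)"
proof -
  define \<delta> where "\<delta> s = v + f s *\<^sub>R u" for s
  define c where "c = \<langle>u, t v\<rangle>"
  define sol where "sol s = t v - inverse (quad v) *\<^sub>R ((f s *\<^sub>R v + ((f s)\<^sup>2 / 2) *\<^sub>R u) \<cdot> c)" for s
  have uv: "\<langle>u, v\<rangle> = 0" using u(1) by (simp add: form_eq_0_commute)
  have \<delta>_form: "\<langle>\<delta> s, x\<rangle> = \<langle>v, x\<rangle> + f s *\<^sub>R \<langle>u, x\<rangle>" for s x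
    by (simp add: \<delta>_def form_add_left form_scaleR_left)
  have u\<delta>: "\<langle>u, \<delta> s\<rangle> = 0" and \<delta>u: "\<langle>\<delta> s, u\<rangle> = 0" for s
    using u uv by (simp_all add: \<delta>_def form_add_right form_scaleR_right form_add_left form_scaleR_left)
  have quad_\<delta>: "quad (\<delta> s) = quad v" for s
  proof -
    have "\<langle>\<delta> s, \<delta> s\<rangle> = \<langle>v, v\<rangle>"
      unfolding \<delta>_form u\<delta> by (simp add: \<delta>_def form_add_right form_scaleR_right u)
    then show ?thesis by (simp add: quad_def re_form_def)
  qed
  have q\<delta>: "quad (\<delta> s) \<noteq> 0" for s using v by (simp add: quad_\<delta>)
  have pt_\<gamma>: "pt (\<gamma> s) = pt (\<delta> s)" if "s \<in> {a..b}" for s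
    using k(1)[OF that] by (simp add: k(2)[OF that] \<delta>_def pt_smul)
  have q\<gamma>: "\<forall>s\<in>{a..b}. quad (\<gamma> s) \<noteq> 0"
    using k q\<delta> by (simp add: quad_smul \<delta>_def)
  obtain f' where f': "\<And>s. s \<in> {a..b} \<Longrightarrow> (f has_real_derivative f' s) (at s within {a..b})"
    using f(3) unfolding real_differentiable_def by metis
  have \<delta>': "(\<delta> has_vector_derivative f' s *\<^sub>R u) (at s within {a..b})" if "s \<in> {a..b}" for s
    unfolding \<delta>_def[abs_def] using f'[OF that] by (auto intro!: derivative_eq_intros)
  have sol': "(sol has_vector_derivative - (f' s * inverse (quad v)) *\<^sub>R (\<delta> s \<cdot> c)) (at s within {a..b})"
    if "s \<in> {a..b}" for s
  proof -
    have "((\<lambda>s. f s *\<^sub>R v + ((f s)\<^sup>2 / 2) *\<^sub>R u) has_vector_derivative f' s *\<^sub>R \<delta> s) (at s within {a..b})"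
      using f'[OF that] by (auto intro!: derivative_eq_intros simp: \<delta>_def scaleR_add_right)
    from bounded_linear.has_vector_derivative[OF smul.bounded_linear_left this, of c]
    have "((\<lambda>s. (f s *\<^sub>R v + ((f s)\<^sup>2 / 2) *\<^sub>R u) \<cdot> c) has_vector_derivative f' s *\<^sub>R (\<delta> s \<cdot> c)) (at s within {a..b})"
      by (simp add: smul_scaleR_left)
    from has_vector_derivative_diff[OF has_vector_derivative_const[of "t v"]
        bounded_linear.has_vector_derivative[OF bounded_linear_scaleR_right this, of "inverse (quad v)"]]
    show ?thesis
      by (simp add: sol_def[abs_def] mult.commute)
  qed
  have sol_ends: "sol a = t v" "sol b = t v - inverse (quad v) *\<^sub>R ((v + (1 / 2) *\<^sub>R u) \<cdot> c)"
    by (simp_all add: sol_def f smul.zero_left)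
  have tv: "\<langle>v, t v\<rangle> = 0" using tangent_orthogonal[OF v t] .
  have pt_b: "pt (\<gamma> b) = pt (v + u)" and pt_a: "pt (\<gamma> a) = pt v" and \<delta>_ends: "\<delta> a = v" "\<delta> b = v + u"
    using pt_\<gamma>[of a] pt_\<gamma>[of b] ab by (simp_all add: \<delta>_def f)
  show ?thesis
  proof
    assume "is_parallel_transport nabla a b \<gamma> t t'"
    then obtain T where T: "parallel_along nabla a b \<gamma> T" "T a = t" "T b = t'"
      unfolding is_parallel_transport_def by blast
    have T_tangent: "T s \<in> tangent (pt (\<delta> s))" if "s \<in> {a..b}" for s
      using T(1) that by (simp add: parallel_along_def pt_\<gamma>)
    define w where "w s = T s (\<delta> s)" for s
    have "\<exists>w'. (w has_vector_derivative w') (at s within {a..b}) \<and> pi (pt (\<delta> s)) w' = 0"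
      if s: "s \<in> {a..b}" for s
    proof -
      obtain T' where T': "\<And>x. ((\<lambda>r. T r x) has_vector_derivative T' x) (at s within {a..b})"
        "pi (pt (\<gamma> s)) (T' (\<gamma> s)) = 0"
        using T(1) s unfolding parallel_along_iff[OF lc ab q\<gamma> \<gamma>] by blast
      have T_\<delta>: "T r (\<delta> x) = T r v + f x *\<^sub>R T r u" if "r \<in> {a..b}" for r x
        using tangent_imp_Lin[OF T_tangent[OF that]] by (simp add: \<delta>_def Lin_add Lin_scaleR)
      have "((\<lambda>r. T r v + f s *\<^sub>R T r u) has_vector_derivative T' v + f s *\<^sub>R T' u) (at s within {a..b})"
        by (intro has_vector_derivative_add T'(1) bounded_linear.has_vector_derivative[OF bounded_linear_scaleR_right])
      then have "((\<lambda>r. T r (\<delta> s)) has_vector_derivative T' v + f s *\<^sub>R T' u) (at s within {a..b})"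
        by (rule has_vector_derivative_transform[OF s, rotated]) (rule T_\<delta>)
      then have T'_\<delta>: "T' (\<delta> s) = T' v + f s *\<^sub>R T' u"
        using vector_derivative_unique_interval[OF ab s T'(1)] by blast
      have "((\<lambda>r. T r (\<delta> s) \<cdot> k s) has_vector_derivative T' (\<delta> s) \<cdot> k s) (at s within {a..b})"
        by (rule bounded_linear.has_vector_derivative[OF smul.bounded_linear_left T'(1)])
      then have "((\<lambda>r. T r (\<delta> s \<cdot> k s)) has_vector_derivative T' (\<delta> s) \<cdot> k s) (at s within {a..b})"
        by (rule has_vector_derivative_transform[OF s, rotated])
          (simp add: Lin_smul[OF tangent_imp_Lin[OF T_tangent]])
      then have "T' (\<gamma> s) = T' (\<delta> s) \<cdot> k s"
        using vector_derivative_unique_interval[OF ab s T'(1)] k(2)[OF s] by (simp add: \<delta>_def)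
      then have "pi (pt (\<delta> s)) (T' (\<delta> s)) \<cdot> k s = 0"
        using T'(2) by (simp add: pt_\<gamma>[OF s] pi_smul[OF q\<delta>])
      then have "pi (pt (\<delta> s)) (T' (\<delta> s)) = 0"
        using k(1)[OF s] by (simp add: smul_eq_0_iff)
      moreover have "(w has_vector_derivative T' (\<delta> s)) (at s within {a..b})"
      proof -
        have "T s u = 0" using tangent_kernel[OF q\<delta> T_tangent[OF s] \<delta>u] .
        then have "((\<lambda>r. T r v + f r *\<^sub>R T r u) has_vector_derivative T' (\<delta> s)) (at s within {a..b})"
          unfolding T'_\<delta>
          using has_vector_derivative_add[OF T'(1)[of v] has_vector_derivative_scaleR[OF f'[OF s] T'(1)[of u]]]
          by simp
        then show ?thesis
          by (rule has_vector_derivative_transform[OF s, rotated]) (simp add: w_def T_\<delta>)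
      qed
      ultimately show ?thesis by blast
    qed
    then obtain w' where w': "\<And>s. s \<in> {a..b} \<Longrightarrow> (w has_vector_derivative w' s) (at s within {a..b})"
      and pi_w': "\<And>s. s \<in> {a..b} \<Longrightarrow> pi (pt (\<delta> s)) (w' s) = 0"
      by metis
    have w'_eq: "w' s = inverse (quad v) *\<^sub>R (\<delta> s \<cdot> \<langle>\<delta> s, w' s\<rangle>)" if "s \<in> {a..b}" for s
      using pi_w'[OF that] by (simp add: pi_pt v quad_\<delta>)
    have "((\<lambda>r. \<langle>u, w r\<rangle>) has_vector_derivative 0) (at s within {a..b})" if s: "s \<in> {a..b}" for s
    proof -
      have "\<langle>u, w' s\<rangle> = 0"
        by (subst w'_eq[OF s]) (simp add: form_scaleR_right form_smul_right u\<delta>)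
      then show ?thesis
        using bounded_linear.has_vector_derivative[OF form.bounded_linear_right w'[OF s], of u] by simp
    qed
    then have "\<langle>u, w s\<rangle> = \<langle>u, w a\<rangle>" if "s \<in> {a..b}" for s
      using has_vector_derivative_zero_interval[of a b "\<lambda>r. \<langle>u, w r\<rangle>" s a] that ab by simp
    then have uw: "\<langle>u, w s\<rangle> = c" if "s \<in> {a..b}" for s
      using that by (simp add: w_def \<delta>_ends T(2) c_def)
    \<comment> \<open>Differentiate \<open>\<langle>\<delta>, w\<rangle> = 0\<close>.\<close>
    have "\<langle>\<delta> s, w' s\<rangle> = - f' s *\<^sub>R c" if s: "s \<in> {a..b}" for s
    proof -
      have "((\<lambda>r. \<langle>\<delta> r, w r\<rangle>) has_vector_derivative \<langle>\<delta> s, w' s\<rangle> + \<langle>f' s *\<^sub>R u, w s\<rangle>) (at s within {a..b})"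
        by (rule form.has_vector_derivative[OF \<delta>'[OF s] w'[OF s]])
      moreover have "((\<lambda>r. \<langle>\<delta> r, w r\<rangle>) has_vector_derivative 0) (at s within {a..b})"
        by (rule has_vector_derivative_transform[OF s, rotated, OF has_vector_derivative_const[of 0]])
          (simp add: w_def tangent_orthogonal[OF q\<delta> T_tangent])
      ultimately have "\<langle>\<delta> s, w' s\<rangle> + \<langle>f' s *\<^sub>R u, w s\<rangle> = 0"
        by (rule vector_derivative_unique_interval[OF ab s])
      then show ?thesis
        by (simp add: form_scaleR_left uw[OF s] eq_neg_iff_add_eq_0)
    qed
    then have "w' s = - (f' s * inverse (quad v)) *\<^sub>R (\<delta> s \<cdot> c)" if "s \<in> {a..b}" for s
      using w'_eq[OF that] that by (simp add: smul_scaleR_right smul.minus_right mult.commute)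
    then have "((\<lambda>r. w r - sol r) has_vector_derivative 0) (at s within {a..b})" if "s \<in> {a..b}" for s
      using has_vector_derivative_diff[OF w'[OF that] sol'[OF that]] that by simp
    then have "w b - sol b = w a - sol a"
      by (rule has_vector_derivative_zero_interval) (use ab in auto)
    moreover have "w a = sol a" by (simp add: w_def \<delta>_ends T(2) sol_ends)
    ultimately have "w b = sol b" by simp
    then show "t' \<in> tangent (pt (v + u)) \<and>
      t' (v + u) = t v - inverse (quad v) *\<^sub>R ((v + (1 / 2) *\<^sub>R u) \<cdot> \<langle>u, t v\<rangle>)"
      using T_tangent[of b] ab by (simp add: w_def T(3) \<delta>_ends sol_ends c_def)
  next
    assume t': "t' \<in> tangent (pt (v + u)) \<and>
      t' (v + u) = t v - inverse (quad v) *\<^sub>R ((v + (1 / 2) *\<^sub>R u) \<cdot> \<langle>u, t v\<rangle>)"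
    define T where "T s = rank_one (\<delta> s) (sol s)" for s
    have sol_orth: "\<langle>\<delta> s, sol s\<rangle> = 0" for s
      using v by (simp add: \<delta>_form sol_def form.diff_right form_scaleR_right form_smul_right form_add_right
          form_self[of v] tv u uv c_def[symmetric] scaleR_diff_right)
    have T_tangent: "T s \<in> tangent (pt (\<delta> s))" for s
      unfolding T_def by (rule rank_one_tangent[OF q\<delta> sol_orth])
    have "parallel_along nabla a b \<gamma> T"
      unfolding parallel_along_iff[OF lc ab q\<gamma> \<gamma>]
    proof (intro ballI conjI exI allI)
      fix s assume s: "s \<in> {a..b}"
      show "T s \<in> tangent (pt (\<gamma> s))" using T_tangent pt_\<gamma>[OF s] by simp
      define d where "d = - (f' s * inverse (quad v)) *\<^sub>R (\<delta> s \<cdot> c)"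
      define T' where "T' x = inverse (quad v) *\<^sub>R (sol s \<cdot> \<langle>f' s *\<^sub>R u, x\<rangle> + d \<cdot> \<langle>\<delta> s, x\<rangle>)" for x
      show "((\<lambda>r. T r x) has_vector_derivative T' x) (at s within {a..b})" for x
        unfolding T_def rank_one_def quad_\<delta> T'_def d_def
        by (intro bounded_linear.has_vector_derivative[OF bounded_linear_scaleR_right] smul.has_vector_derivative
            sol' s bounded_linear.has_vector_derivative[OF form.bounded_linear_left] \<delta>')
      have "T' (\<delta> s) = d"
        using v by (simp add: T'_def form_scaleR_left u\<delta> smul.zero_right form_self quad_\<delta> smul_scaleR_right)
      also have "d = \<delta> s \<cdot> (- (f' s * inverse (quad v)) *\<^sub>R c)"
        by (simp only: d_def smul_scaleR_right)
      finally have "T' (\<delta> s) = \<delta> s \<cdot> (- (f' s * inverse (quad v)) *\<^sub>R c)" .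
      moreover have "T' (\<gamma> s) = T' (\<delta> s) \<cdot> k s"
        by (simp add: k(2)[OF s] \<delta>_def[symmetric] T'_def form_smul_right smul_mult smul_add_left smul_scaleR_left)
      ultimately show "pi (pt (\<gamma> s)) (T' (\<gamma> s)) = 0"
        by (simp only: pt_\<gamma>[OF s] smul_mult[symmetric] pi_smul_self[OF q\<delta>])
    qed
    moreover have "T a = t"
      by (rule tangent_ext[OF v _ t]) (use T_tangent[of a] v in \<open>simp_all add: \<delta>_ends T_def sol_ends rank_one_self\<close>)
    moreover have "T b = t'"
      by (rule tangent_ext[where v = "v + u"])
        (use T_tangent[of b] q\<delta>[of b] t' in \<open>simp_all add: \<delta>_ends T_def sol_ends rank_one_self c_def\<close>)
    ultimately show "is_parallel_transport nabla a b \<gamma> t t'"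
      unfolding is_parallel_transport_def by blast
  qed
qed

lemma parallel_transport_eq_Eu:
  assumes "\<sigma> \<noteq> 0" "levi_civita \<sigma> nabla" "p \<in> nonisotropic" "q \<in> nonisotropic" "p \<noteq> q"
    and "euclidean_line (line_through p q)" "t \<in> tangent p" "parametrizes_segment p q a b \<gamma>"
  shows "is_parallel_transport nabla a b \<gamma> t t' \<longleftrightarrow> t' = Eu p t q"
proof -
  have "a < b" and "C_k (Suc 0) {a..b} \<gamma>"
    using assms(8) by (auto simp: parametrizes_segment_def smooth_on_def)
  then have \<gamma>: "\<gamma> differentiable_on {a..b}" by simp
  obtain v u f where pq: "p = pt v" "q = pt (v + u)" and v: "quad v \<noteq> 0" and u: "\<langle>v, u\<rangle> = 0" "\<langle>u, u\<rangle> = 0"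
    and f: "f a = (0::real)" "f b = 1" "\<And>s. s \<in> {a..b} \<Longrightarrow> f differentiable (at s within {a..b})"
    and "\<And>s. s \<in> {a..b} \<Longrightarrow> \<exists>k. k \<noteq> 0 \<and> \<gamma> s = (v + f s *\<^sub>R u) \<cdot> k"
    by (rule geodesic_on_euclidean_line[OF assms(3,4,5,6,8)]) (rule that)
  then obtain k where k: "\<And>s. s \<in> {a..b} \<Longrightarrow> k s \<noteq> 0" "\<And>s. s \<in> {a..b} \<Longrightarrow> \<gamma> s = (v + f s *\<^sub>R u) \<cdot> k s"
    by metis
  have t: "t \<in> tangent (pt v)" using assms(7) pq by simp
  have "\<langle>u, v\<rangle> = 0" using u(1) by (simp add: form_eq_0_commute)
  then have qw: "quad (v + u) \<noteq> 0"
    using v u by (simp add: quad_def re_form_def form_add_left form_add_right)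
  note Eu = Eu_tangent[OF v qw tangent_imp_Lin[OF t]]
  have "is_parallel_transport nabla a b \<gamma> t t' \<longleftrightarrow> t' \<in> tangent (pt (v + u)) \<and>
      t' (v + u) = t v - inverse (quad v) *\<^sub>R ((v + (1 / 2) *\<^sub>R u) \<cdot> \<langle>u, t v\<rangle>)"
    by (rule parallel_transport_on_euclidean_line[OF assms(2,1) \<open>a < b\<close> v u f \<gamma> k t])
  also have "\<dots> \<longleftrightarrow> t' \<in> tangent (pt (v + u)) \<and> t' (v + u) = Eu (pt v) t (pt (v + u)) (v + u)"
    by (simp only: Eu_on_euclidean_line[OF v u t])
  also have "\<dots> \<longleftrightarrow> t' = Eu p t q"
    unfolding pq using tangent_ext[OF qw _ Eu] Eu by blast
  finally show ?thesis .
qed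

end

theorem corollary5p9:
  fixes smul :: "'v::euclidean_space \<Rightarrow> 'k::hermitian_scalar \<Rightarrow> 'v"
    and form :: "'v \<Rightarrow> 'v \<Rightarrow> 'k"
    and \<sigma> :: real
    and nabla :: "('v set \<Rightarrow> 'v \<Rightarrow> 'v) \<Rightarrow> ('v set \<Rightarrow> 'v \<Rightarrow> 'v) \<Rightarrow> ('v set \<Rightarrow> 'v \<Rightarrow> 'v)"
    and p q :: "'v set"
    and t :: "'v \<Rightarrow> 'v"
    and a b :: real
    and \<gamma> :: "real \<Rightarrow> 'v"
  assumes "hermitian_space smul form"
    and "\<sigma> = 1 \<or> \<sigma> = -1"
    and "hermitian_space.levi_civita smul form \<sigma> nabla"
    and "p \<in> hermitian_space.nonisotropic smul form"
    and "q \<in> hermitian_space.nonisotropic smul form"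
    and "p \<noteq> q"
    and "hermitian_space.euclidean_line smul form (hermitian_space.line_through p q)"
    and "t \<in> hermitian_space.tangent smul form p"
    and "hermitian_space.parametrizes_segment smul form p q a b \<gamma>"
  shows "\<forall>t'. hermitian_space.is_parallel_transport smul form nabla a b \<gamma> t t'
           \<longleftrightarrow> t' = hermitian_space.Eu smul form p t q"
proof -
  interpret hermitian_space smul form by (fact assms(1))
  show ?thesis
    using parallel_transport_eq_Eu[of \<sigma> nabla p q t a b \<gamma>] assms(2-9) by auto
qed

end
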